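(* For non-trivial $3$-wise intersecting families and a real number $p$ with $0<p<1$, writing $q=1-p$, we have $$M_3(p)=\begin{cases} p^2 & \text{if } p\leq\frac13,\\ 4p^3q+p^4 & \text{if } \frac13\leq p\leq\frac12,\\ p & \text{if } \frac12<p\leq\frac23,\\ 1 & \text{if } \frac23<p<1.\end{cases}$$
   Context: Let $[n]=\{1,2,\ldots,n\}$ and let $2^{[n]}$ be its power set. For $0<p<1$, $q=1-p$, the $p$-measure of a family $\mathcal G\subset 2^{[n]}$ is $\mu_p(\mathcal G)=\sum_{G\in\mathcal G}p^{|G|}q^{n-|G|}$. A family $\mathcal G\subset 2^{[n]}$ is $3$-wise intersecting if $G_1\cap G_2\cap G_3\neq\emptyset$ for all $G_1,G_2,G_3\in\mathcal G$ (not necessarily distinct); it is non-trivial if $\bigcap_{G\in\mathcal G}G=\emptyset$. Let $M_3(n,p)$ be the maximum of $\mu_p(\mathcal G)$ over all non-trivial $3$-wise intersecting families $\mathcal G\subset 2^{[n]}$ (such families exist when $n\ge 4$). For fixed $p$, $M_3(n,p)$ is non-decreasing in $n$, and $M_3(p):=\lim_{n\to\infty}M_3(n,p)$. *)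

theory Defs
  imports Complex_Main
begin

definition p_measure :: "nat \<Rightarrow> real \<Rightarrow> nat set set \<Rightarrow> real" where
  "p_measure n p \<G> = (\<Sum>G\<in>\<G>. p ^ card G * (1 - p) ^ (n - card G))"

definition three_wise_intersecting :: "nat set set \<Rightarrow> bool" where
  "three_wise_intersecting \<G> \<longleftrightarrow>
     (\<forall>G1\<in>\<G>. \<forall>G2\<in>\<G>. \<forall>G3\<in>\<G>. G1 \<inter> G2 \<inter> G3 \<noteq> {})"

text \<open>As the intersection of the empty family is \<^term>\<open>UNIV\<close>, the empty family is trivial.\<close>

definition nontrivial_family :: "nat set set \<Rightarrow> bool" where
  "nontrivial_family \<G> \<longleftrightarrow> \<Inter>\<G> = {}"

text \<open>For \<open>n < 4\<close> there is no admissible family, so \<open>M3_fin n p\<close> is the unspecified value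
  \<open>Max {}\<close>. This does not affect the limit.\<close>

definition M3_fin :: "nat \<Rightarrow> real \<Rightarrow> real" where
  "M3_fin n p = Max (p_measure n p `
     {\<G>. \<G> \<subseteq> Pow {1..n} \<and> three_wise_intersecting \<G> \<and> nontrivial_family \<G>})"

definition M3 :: "real \<Rightarrow> real" where
  "M3 p = lim (\<lambda>n. M3_fin n p)"

end

(* By compressions we may assume that the family is an up-set, closed under shifting, and contains
   every [n] - {i}; encode its members as boolean lists and view them as lattice walks.

   If certain prefixes do not occur, sets with prefixes A and B become cross-intersecting, which gives
   mu_p(F_A) + mu_q(F_B) <= 1. Moreover shiftedness and the 3-wise intersecting property force all
   walks in a link F_B to meet a line y = x + t or y = 2x + t. Reflection at the first line yields
   q^t mu_p(F_B) <= p^t mu_q(F_B); the second gives mu_p(F_B) <= s^t where q (s^2 + s) = p.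
   A case distinction on which of the sets [n] - {1,2} and [n] - {1,3} belong to the family turns
   these inequalities into the bounds p^2 and 4 p^3 q + p^4 for p <= 1/2.

   For 1/2 < p <= 2/3 even trivial families have measure at most p: random partitions of the ground
   set into three parts give the bound 2/3 at p = 2/3, and mu_{p^a} <= (mu_p)^a for up-sets, a >= 1,
   transfers it to smaller p. *)

theory Submission
  imports Defs
begin

section \<open>Product measure on boolean lists\<close>

text \<open>For p <= 1/2 trivial families can have measure p, above the claimed value, so
  non-triviality must enter the upper bound. It does so only through members that miss very few
  points: [n] - {1}, and where present [n] - {1,2} or [n] - {1,3}. Against such a member the 3-wise
  condition becomes a 2-wise condition between links. The resulting inequality mixes mu_p with mu_q,
  and reflection turns mu_q back into mu_p. The values p^2 and 4 p^3 q + p^4 differ by p^2 q (3p -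
  1), so near p = 1/3 the estimates have almost no slack; nearer to 1/2 reflection alone is too weak
  and the root s joins in. At 1/2 the value jumps from 5/16 to 1/2, because a majority of the points
  becomes likely only for p > 1/2. Lower bounds come from: sets through 1, 2 and a further point,
  with [n] - {1} and [n] - {2}; sets with at least three of four points; sets through 1 with more
  than half of the other points, with [n] - {1}; sets with more than 2n/3 points. The second has the
  claimed measure for every n >= 4, the others are used through limits.\<close>

primrec expect :: "real \<Rightarrow> nat \<Rightarrow> (bool list \<Rightarrow> real) \<Rightarrow> real" where
  "expect p 0 f = f []"
| "expect p (Suc n) f = p * expect p n (\<lambda>xs. f (True # xs)) + (1 - p) * expect p n (\<lambda>xs. f (False # xs))"

abbreviation mu :: "real \<Rightarrow> nat \<Rightarrow> (bool list \<Rightarrow> bool) \<Rightarrow> real" where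
  "mu p n P \<equiv> expect p n (\<lambda>xs. of_bool (P xs))"

lemma expect_mono:
  assumes "0 \<le> p" "p \<le> 1" "\<And>xs. length xs = n \<Longrightarrow> f xs \<le> g xs"
  shows "expect p n f \<le> expect p n g"
  using assms(3)
proof (induction n arbitrary: f g)
  case (Suc n)
  have "expect p n (\<lambda>xs. f (b # xs)) \<le> expect p n (\<lambda>xs. g (b # xs))" for b
    using Suc.prems by (intro Suc.IH) auto
  then show ?case using assms(1,2) by (auto intro!: add_mono mult_left_mono)
qed simp

lemma expect_const [simp]: "expect p n (\<lambda>_. c) = c"
  by (induction n) (auto simp: algebra_simps)

lemma expect_add: "expect p n (\<lambda>xs. f xs + g xs) = expect p n f + expect p n g"
  by (induction n arbitrary: f g) (auto simp: algebra_simps)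

lemma expect_cmult: "expect p n (\<lambda>xs. c * f xs) = c * expect p n f"
  by (induction n arbitrary: f) (auto simp: algebra_simps)

lemma mu_nonneg: "0 \<le> p \<Longrightarrow> p \<le> 1 \<Longrightarrow> 0 \<le> mu p n P"
  using expect_mono[of p n "\<lambda>_. 0" "\<lambda>xs. of_bool (P xs)"] by simp

lemma mu_le_1: "0 \<le> p \<Longrightarrow> p \<le> 1 \<Longrightarrow> mu p n P \<le> 1"
  using expect_mono[of p n "\<lambda>xs. of_bool (P xs)" "\<lambda>_. 1"] by simp

lemma mu_mono:
  assumes "0 \<le> p" "p \<le> 1" "\<And>xs. length xs = n \<Longrightarrow> P xs \<Longrightarrow> Q xs"
  shows "mu p n P \<le> mu p n Q"
  using assms by (intro expect_mono) auto

lemma mu_eq_0: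
  assumes "\<And>xs. length xs = n \<Longrightarrow> \<not> P xs"
  shows "mu p n P = 0"
  using assms
proof (induction n arbitrary: P)
  case (Suc n)
  have "mu p n (\<lambda>xs. P (b # xs)) = 0" for b using Suc.prems by (intro Suc.IH) auto
  then show ?case by simp
qed simp

definition upclosed :: "nat \<Rightarrow> (bool list \<Rightarrow> bool) \<Rightarrow> bool" where
  "upclosed n P \<longleftrightarrow> (\<forall>xs ys. length xs = n \<longrightarrow> list_all2 (\<longrightarrow>) xs ys \<longrightarrow> P xs \<longrightarrow> P ys)"

lemma upclosed_Cons: "upclosed (Suc n) P \<Longrightarrow> upclosed n (\<lambda>xs. P (b # xs))"
  unfolding upclosed_def by (metis length_Cons list.rel_intros(2))

lemma upclosed_False_True:
  assumes "upclosed (Suc n) P" "length xs = n" "P (False # xs)"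
  shows "P (True # xs)"
proof -
  have "list_all2 (\<longrightarrow>) (False # xs) (True # xs)" by (simp add: list_all2_refl)
  then show ?thesis using assms unfolding upclosed_def by (metis length_Cons)
qed

lemma mu_mono_prob:
  assumes "0 \<le> p" "p \<le> p'" "p' \<le> 1" "upclosed n P"
  shows "mu p n P \<le> mu p' n P"
  using assms(4)
proof (induction n arbitrary: P)
  case (Suc n)
  let ?a = "\<lambda>b r. mu r n (\<lambda>xs. P (b # xs))"
  have 1: "?a b p \<le> ?a b p'" for b using Suc by (simp add: upclosed_Cons)
  have 2: "?a False p \<le> ?a True p"
    using assms upclosed_False_True[OF Suc.prems] by (intro mu_mono) auto
  have "mu p (Suc n) P = ?a False p + p * (?a True p - ?a False p)" by (simp add: algebra_simps)
  also have "\<dots> \<le> ?a False p + p' * (?a True p - ?a False p)"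
    using 2 assms by (simp add: mult_right_mono)
  also have "\<dots> = p' * ?a True p + (1 - p') * ?a False p" by (simp add: algebra_simps)
  also have "\<dots> \<le> mu p' (Suc n) P"
    using 1 assms by (auto intro!: add_mono mult_left_mono)
  finally show ?case .
qed simp

section \<open>Cross-intersecting families, walks and the order behind shifting\<close>

fun disj2 :: "bool list \<Rightarrow> bool list \<Rightarrow> bool" where
  "disj2 (x # xs) (y # ys) \<longleftrightarrow> \<not> (x \<and> y) \<and> disj2 xs ys"
| "disj2 _ _ \<longleftrightarrow> True"

fun disj3 :: "bool list \<Rightarrow> bool list \<Rightarrow> bool list \<Rightarrow> bool" where
  "disj3 (x # xs) (y # ys) (z # zs) \<longleftrightarrow> \<not> (x \<and> y \<and> z) \<and> disj3 xs ys zs"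
| "disj3 _ _ _ \<longleftrightarrow> True"

lemma disj3_replicate_True:
  "length xs = n \<Longrightarrow> length ys = n \<Longrightarrow> disj3 xs ys (replicate n True) \<longleftrightarrow> disj2 xs ys"
  by (induction n arbitrary: xs ys) (auto simp: length_Suc_conv)

text \<open>A random set of density p and its complement, of density 1 - p, are disjoint, so at most
  one of the two events can occur.\<close>

lemma mu_cross2:
  assumes "0 \<le> p" "p \<le> 1"
    "\<And>xs ys. length xs = n \<Longrightarrow> length ys = n \<Longrightarrow> P xs \<Longrightarrow> Q ys \<Longrightarrow> \<not> disj2 xs ys"
  shows "mu p n P + mu (1 - p) n Q \<le> 1"
  using assms(3)
proof (induction n arbitrary: P Q)
  case 0
  then show ?case by force
next
  case (Suc n)
  let ?P = "\<lambda>b. mu p n (\<lambda>xs. P (b # xs))" and ?Q = "\<lambda>b. mu (1 - p) n (\<lambda>xs. Q (b # xs))"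
  have 1: "?P True + ?Q False \<le> 1" "?P False + ?Q True \<le> 1"
    by (intro Suc.IH; use Suc.prems[of "_ # _" "_ # _"] in fastforce)+
  have "mu p (Suc n) P + mu (1 - p) (Suc n) Q
    = p * (?P True + ?Q False) + (1 - p) * (?P False + ?Q True)" by (simp add: algebra_simps)
  also have "\<dots> \<le> p * 1 + (1 - p) * 1"
    using 1 assms by (intro add_mono mult_left_mono) auto
  finally show ?case by simp
qed

text \<open>Leave each point out of exactly one of three sets, chosen uniformly. Each set has
  density 2/3 and the three have no common point, so at most two of the events occur.\<close>

lemma mu_cross3:
  assumes "\<And>xs ys zs. length xs = n \<Longrightarrow> length ys = n \<Longrightarrow> length zs = n \<Longrightarrow>
      P xs \<Longrightarrow> Q ys \<Longrightarrow> R zs \<Longrightarrow> \<not> disj3 xs ys zs"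
  shows "mu (2/3) n P + mu (2/3) n Q + mu (2/3) n R \<le> 2"
  using assms
proof (induction n arbitrary: P Q R)
  case 0
  then show ?case by force
next
  case (Suc n)
  let ?m = "\<lambda>P b. mu (2/3) n (\<lambda>xs. P (b # xs))"
  have "?m P a + ?m Q b + ?m R c \<le> 2" if "\<not> (a \<and> b \<and> c)" for a b c
    by (intro Suc.IH) (use Suc.prems[of "a # _" "b # _" "c # _"] that in simp)
  from this[of True True False] this[of True False True] this[of False True True]
  show ?case by simp
qed

text \<open>\<^term>\<open>hit a t xs\<close>: reading \<open>True\<close> as an up step and \<open>False\<close> as a right step, the walk \<open>xs\<close> meets
  the line \<open>y = a x + t\<close>.\<close>

fun hit :: "nat \<Rightarrow> nat \<Rightarrow> bool list \<Rightarrow> bool" where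
  "hit a 0 xs \<longleftrightarrow> True"
| "hit a (Suc t) [] \<longleftrightarrow> False"
| "hit a (Suc t) (x # xs) \<longleftrightarrow> (if x then hit a t xs else hit a (Suc t + a) xs)"

fun falses :: "bool list \<Rightarrow> nat \<Rightarrow> nat" where
  "falses [] m = 0"
| "falses (x # xs) 0 = 0"
| "falses (x # xs) (Suc m) = (if x then 0 else 1) + falses xs m"

lemma falses_0 [simp]: "falses xs 0 = 0" by (cases xs) auto

lemma falses_replicate_True [simp]: "falses (replicate n True) m = 0"
proof (induction n arbitrary: m)
  case (Suc n)
  then show ?case by (cases m) auto
qed simp

text \<open>A walk that stays strictly below y = a x + t has made at most a f + t - 1 up steps when
  it has made f right steps; adding f gives the length of the prefix. In this form the failure to
  hit is confronted with \<open>no_cover\<close>.\<close>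

lemma not_hit_falses:
  assumes "\<not> hit a t xs" "m \<le> length xs"
  shows "m + 1 \<le> (a + 1) * falses xs m + t"
  using assms
proof (induction a t xs arbitrary: m rule: hit.induct)
  case (3 a t x xs)
  then show ?case by (cases m) (fastforce simp: algebra_simps split: if_splits)+
qed auto

text \<open>At the first hit the prefix has t more up steps than right steps, so its weight at p is
  (p/q)^t times its weight at q = 1 - p. After the hit, p <= q and up-closedness give mu_p <=
  mu_q.\<close>

lemma mu_hit_reflect:
  assumes "0 \<le> p" "p \<le> 1/2" "upclosed n P" "\<And>xs. length xs = n \<Longrightarrow> P xs \<Longrightarrow> hit 1 t xs"
  shows "(1 - p) ^ t * mu p n P \<le> p ^ t * mu (1 - p) n P"
  using assms(3,4)
proof (induction n arbitrary: P t)
  case 0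
  show ?case
  proof (cases t)
    case (Suc t')
    then show ?thesis using 0(2)[of "[]"] by auto
  qed simp
next
  case (Suc n)
  show ?case
  proof (cases t)
    case 0
    then show ?thesis using mu_mono_prob[OF _ _ _ Suc.prems(1), of p "1 - p"] assms
      by (simp del: expect.simps)
  next
    case t: (Suc u)
    define A where "A b = mu p n (\<lambda>xs. P (b # xs))" for b
    define B where "B b = mu (1 - p) n (\<lambda>xs. P (b # xs))" for b
    have 1: "(1 - p) ^ u * A True \<le> p ^ u * B True"
      unfolding A_def B_def using Suc.prems(2)[of "True # _"] t
      by (intro Suc.IH upclosed_Cons[OF Suc.prems(1)]) auto
    have 2: "(1 - p) ^ (u + 2) * A False \<le> p ^ (u + 2) * B False"
      unfolding A_def B_def using Suc.prems(2)[of "False # _"] t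
      by (intro Suc.IH upclosed_Cons[OF Suc.prems(1)]) auto
    have "(1 - p) ^ t * mu p (Suc n) P
        = (p * (1 - p)) * ((1 - p) ^ u * A True) + (1 - p) ^ (u + 2) * A False"
      by (simp add: t A_def algebra_simps)
    also have "\<dots> \<le> (p * (1 - p)) * (p ^ u * B True) + p ^ (u + 2) * B False"
      using 1 2 assms by (intro add_mono mult_left_mono) auto
    also have "\<dots> = p ^ t * mu (1 - p) (Suc n) P"
      by (simp add: t B_def algebra_simps)
    finally show ?thesis .
  qed
qed

text \<open>Gambler's ruin: an up step brings the line one unit closer, a right step moves it two
  units away, so s^t has to satisfy s = p + q s^3. Dividing out the root s = 1 leaves q (s^2 + s) =
  p.\<close>

lemma mu_hit_le:
  assumes "0 \<le> p" "p \<le> 1" "0 \<le> s" and s: "(1 - p) * (s\<^sup>2 + s) = p"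
    and "\<And>xs. length xs = n \<Longrightarrow> P xs \<Longrightarrow> hit 2 t xs"
  shows "mu p n P \<le> s ^ t"
  using assms(5)
proof (induction n arbitrary: P t)
  case 0
  show ?case
  proof (cases t)
    case (Suc t')
    then show ?thesis using 0[of "[]"] assms(3) by auto
  qed simp
next
  case (Suc n)
  show ?case
  proof (cases t)
    case 0
    then show ?thesis using mu_le_1[of p "Suc n" P] assms by (simp del: expect.simps)
  next
    case t: (Suc u)
    have 1: "mu p n (\<lambda>xs. P (True # xs)) \<le> s ^ u"
      using Suc.prems[of "True # _"] t by (intro Suc.IH) auto
    have 2: "mu p n (\<lambda>xs. P (False # xs)) \<le> s ^ (u + 3)"
      using Suc.prems[of "False # _"] t by (intro Suc.IH) (auto simp: eval_nat_numeral)
    have "mu p (Suc n) P \<le> p * s ^ u + (1 - p) * s ^ (u + 3)"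
      using 1 2 assms by (auto intro!: add_mono mult_left_mono)
    also have "\<dots> = s ^ u * (p + (1 - p) * s ^ 3)" by (simp add: algebra_simps power_add)
    also have "p + (1 - p) * s ^ 3 = s + (s - 1) * ((1 - p) * (s\<^sup>2 + s) - p)"
      by (simp add: algebra_simps power2_eq_square power3_eq_cube)
    also have "\<dots> = s" using s by simp
    finally show ?thesis by (simp add: t mult.commute)
  qed
qed

text \<open>The counter j is the surplus of \<open>False\<close> entries that the first list has
  over the second in the part already read; it must never become negative.\<close>

fun dom :: "nat \<Rightarrow> bool list \<Rightarrow> bool list \<Rightarrow> bool" where
  "dom j (x # xs) (y # ys) \<longleftrightarrow>
     (if x = y then dom j xs ys else if y then dom (Suc j) xs ys else 0 < j \<and> dom (j - 1) xs ys)"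
| "dom j [] [] \<longleftrightarrow> True"
| "dom _ _ _ \<longleftrightarrow> False"

lemma dom_refl [simp]: "dom j xs xs" by (induction xs) auto

lemma dom_replicate_True [simp]: "length xs = n \<Longrightarrow> dom j xs (replicate n True)"
  by (induction n arbitrary: j xs) (auto simp: length_Suc_conv)

lemma dom_imp: "list_all2 (\<longrightarrow>) xs ys \<Longrightarrow> dom j xs ys"
  by (induction xs ys arbitrary: j rule: list_all2_induct) auto

lemma dom_length: "dom j xs ys \<Longrightarrow> length ys = length xs"
  by (induction j xs ys rule: dom.induct) (auto split: if_splits)

text \<open>Greedy: at each position, one of the three lists still has a \<open>False\<close> in stock to be spent there.\<close>

lemma dom_disj3:
  assumes "length xs = n" "length ys = n" "length zs = n"
    "\<And>m. m \<le> n \<Longrightarrow> m \<le> a + b + c + falses xs m + falses ys m + falses zs m"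
  shows "\<exists>xs' ys' zs'. dom a xs xs' \<and> dom b ys ys' \<and> dom c zs zs' \<and> disj3 xs' ys' zs'"
  using assms
proof (induction n arbitrary: xs ys zs a b c)
  case 0
  then show ?case by (intro exI[of _ "[]"]) auto
next
  case (Suc n)
  obtain x xs1 y ys1 z zs1 where e: "xs = x # xs1" "ys = y # ys1" "zs = z # zs1"
    "length xs1 = n" "length ys1 = n" "length zs1 = n"
    using Suc.prems(1-3) by (auto simp: length_Suc_conv)
  let ?o = "\<lambda>x. if x then 0 else 1 :: nat"
  have H: "Suc m \<le> (a + ?o x) + (b + ?o y) + (c + ?o z) + falses xs1 m + falses ys1 m + falses zs1 m"
    if "m \<le> n" for m
    using Suc.prems(4)[of "Suc m"] that by (auto simp: e split: if_splits)
  have "0 < a + ?o x \<or> 0 < b + ?o y \<or> 0 < c + ?o z" using H[of 0] by auto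
  then show ?case
  proof (elim disjE)
    assume *: "0 < a + ?o x"
    have "\<exists>xs' ys' zs'. dom (a + ?o x - 1) xs1 xs' \<and> dom (b + ?o y) ys1 ys' \<and> dom (c + ?o z) zs1 zs'
        \<and> disj3 xs' ys' zs'"
      using e H * by (intro Suc.IH) force+
    then obtain xs' ys' zs' where "dom (a + ?o x - 1) xs1 xs'" "dom (b + ?o y) ys1 ys'"
      "dom (c + ?o z) zs1 zs'" "disj3 xs' ys' zs'" by blast
    with * show ?thesis
      by (intro exI[of _ "False # xs'"] exI[of _ "True # ys'"] exI[of _ "True # zs'"])
        (auto simp: e split: if_splits)
  next
    assume *: "0 < b + ?o y"
    have "\<exists>xs' ys' zs'. dom (a + ?o x) xs1 xs' \<and> dom (b + ?o y - 1) ys1 ys' \<and> dom (c + ?o z) zs1 zs'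
        \<and> disj3 xs' ys' zs'"
      using e H * by (intro Suc.IH) force+
    then obtain xs' ys' zs' where "dom (a + ?o x) xs1 xs'" "dom (b + ?o y - 1) ys1 ys'"
      "dom (c + ?o z) zs1 zs'" "disj3 xs' ys' zs'" by blast
    with * show ?thesis
      by (intro exI[of _ "True # xs'"] exI[of _ "False # ys'"] exI[of _ "True # zs'"])
        (auto simp: e split: if_splits)
  next
    assume *: "0 < c + ?o z"
    have "\<exists>xs' ys' zs'. dom (a + ?o x) xs1 xs' \<and> dom (b + ?o y) ys1 ys' \<and> dom (c + ?o z - 1) zs1 zs'
        \<and> disj3 xs' ys' zs'"
      using e H * by (intro Suc.IH) force+
    then obtain xs' ys' zs' where "dom (a + ?o x) xs1 xs'" "dom (b + ?o y) ys1 ys'"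
      "dom (c + ?o z - 1) zs1 zs'" "disj3 xs' ys' zs'" by blast
    with * show ?thesis
      by (intro exI[of _ "True # xs'"] exI[of _ "True # ys'"] exI[of _ "False # zs'"])
        (auto simp: e split: if_splits)
  qed
qed

section \<open>Shifted families as walks\<close>

text \<open>\<^term>\<open>dom 0 xs ys\<close> means that every prefix of \<open>ys\<close> has at most as many \<open>False\<close> entries as
  that of \<open>xs\<close>; for lists coming from sets, closure under it says up-closed and shifted. In the
  proofs below \<open>x\<close> and \<open>y\<close> denote the measures of links at \<open>p\<close> and \<open>q\<close>, indexed by the prefix.\<close>

locale stable_family =
  fixes n :: nat and P :: "bool list \<Rightarrow> bool"
  assumes dom_closed: "\<And>xs ys. length xs = n \<Longrightarrow> dom 0 xs ys \<Longrightarrow> P xs \<Longrightarrow> P ys"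
    and intersecting: "\<And>xs ys zs. length xs = n \<Longrightarrow> length ys = n \<Longrightarrow> length zs = n \<Longrightarrow>
      P xs \<Longrightarrow> P ys \<Longrightarrow> P zs \<Longrightarrow> \<not> disj3 xs ys zs"
    and drop_first: "P (False # replicate (n - 1) True)"
begin

lemma upclosed: "upclosed n P"
  unfolding upclosed_def using dom_closed dom_imp by blast

text \<open>Otherwise \<open>dom_disj3\<close> would replace the three members by three dominating
  ones, again members, without a common point.\<close>

lemma no_cover:
  assumes "length xs = n" "length ys = n" "length zs = n" "P xs" "P ys" "P zs"
  shows "\<exists>m\<le>n. falses xs m + falses ys m + falses zs m < m"
proof (rule ccontr)
  assume "\<not> ?thesis"
  then have "m \<le> 0 + 0 + 0 + falses xs m + falses ys m + falses zs m" if "m \<le> n" for m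
    using that by (simp add: not_less)
  from dom_disj3[OF assms(1-3) this] obtain xs' ys' zs' where
    d: "dom 0 xs xs'" "dom 0 ys ys'" "dom 0 zs zs'" "disj3 xs' ys' zs'" by blast
  with assms dom_closed have "P xs'" "P ys'" "P zs'" by blast+
  moreover have "length xs' = n" "length ys' = n" "length zs' = n"
    using d assms dom_length by metis+
  ultimately show False using intersecting d(4) by blast
qed

text \<open>The violating prefix of \<open>no_cover\<close> is nonempty, and hypothesis
  \<open>c\<close> rules out length 1. Hence it contains both fixed letters, whose misses can be
  counted separately. In \<open>no_cover3\<close> the second part of \<open>c\<close> rules out
  length 2 in the same way.\<close>

lemma no_cover2:
  assumes n: "n = Suc (Suc N)"
    and l: "length xs = N" "length ys = N" "length zs = N"
    and P: "P (a1 # a2 # xs)" "P (b1 # b2 # ys)" "P (c1 # c2 # zs)"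
    and c: "\<not> (a1 \<and> b1 \<and> c1)"
  shows "\<exists>m\<le>N. of_bool (\<not> a1) + of_bool (\<not> a2) + of_bool (\<not> b1) + of_bool (\<not> b2) + of_bool (\<not> c1)
    + of_bool (\<not> c2) + falses xs m + falses ys m + falses zs m < Suc (Suc m)"
proof -
  obtain m where m: "m \<le> n" "falses (a1 # a2 # xs) m + falses (b1 # b2 # ys) m + falses (c1 # c2 # zs) m < m"
    using no_cover[OF _ _ _ P] l n by auto
  with c obtain k where "m = Suc (Suc k)"
    by (cases m; cases "m - 1") (auto split: if_splits)
  with m n show ?thesis by (intro exI[of _ k]) (auto split: if_splits)
qed

lemma no_cover3:
  assumes n: "n = Suc (Suc (Suc N))"
    and l: "length xs = N" "length ys = N" "length zs = N"
    and P: "P (a1 # a2 # a3 # xs)" "P (b1 # b2 # b3 # ys)" "P (c1 # c2 # c3 # zs)"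
    and c: "\<not> (a1 \<and> b1 \<and> c1)"
      "2 \<le> of_bool (\<not> a1) + of_bool (\<not> b1) + of_bool (\<not> c1) + of_bool (\<not> a2) + of_bool (\<not> b2)
        + (of_bool (\<not> c2) :: nat)"
  shows "\<exists>m\<le>N. of_bool (\<not> a1) + of_bool (\<not> a2) + of_bool (\<not> a3) + of_bool (\<not> b1) + of_bool (\<not> b2)
    + of_bool (\<not> b3) + of_bool (\<not> c1) + of_bool (\<not> c2) + of_bool (\<not> c3)
    + falses xs m + falses ys m + falses zs m < Suc (Suc (Suc m))"
proof -
  obtain m where m: "m \<le> n"
    "falses (a1 # a2 # a3 # xs) m + falses (b1 # b2 # b3 # ys) m + falses (c1 # c2 # c3 # zs) m < m"
    using no_cover[OF _ _ _ P] l n by auto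
  have "m \<noteq> 0" "m \<noteq> 1" using m c(1) by (auto split: if_splits)
  moreover have "m \<noteq> 2" using m c(2) by (auto simp: eval_nat_numeral split: if_splits)
  ultimately obtain k where "m = Suc (Suc (Suc k))"
    by (metis One_nat_def Suc_1 not0_implies_Suc)
  with m n show ?thesis by (intro exI[of _ k]) (auto split: if_splits)
qed

text \<open>The third member contains every free position and, by \<open>c\<close>, completes an
  empty intersection on the fixed ones. So the two links must meet each other, and
  \<open>mu_cross2\<close> applies.\<close>

lemma cross2:
  assumes n: "n = Suc (Suc N)" and p: "0 \<le> p" "p \<le> 1"
    and P: "P (c1 # c2 # replicate N True)"
    and c: "\<not> (a1 \<and> b1 \<and> c1)" "\<not> (a2 \<and> b2 \<and> c2)"
  shows "mu p N (\<lambda>xs. P (a1 # a2 # xs)) + mu (1 - p) N (\<lambda>xs. P (b1 # b2 # xs)) \<le> 1"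
proof (intro mu_cross2 p notI)
  fix xs ys assume "length xs = N" "length ys = N" "P (a1 # a2 # xs)" "P (b1 # b2 # ys)" "disj2 xs ys"
  with P c n intersecting[of "a1 # a2 # xs" "b1 # b2 # ys" "c1 # c2 # replicate N True"]
  show False by (simp add: disj3_replicate_True)
qed

lemma cross3:
  assumes n: "n = Suc (Suc (Suc N))" and p: "0 \<le> p" "p \<le> 1"
    and P: "P (c1 # c2 # c3 # replicate N True)"
    and c: "\<not> (a1 \<and> b1 \<and> c1)" "\<not> (a2 \<and> b2 \<and> c2)" "\<not> (a3 \<and> b3 \<and> c3)"
  shows "mu p N (\<lambda>xs. P (a1 # a2 # a3 # xs)) + mu (1 - p) N (\<lambda>xs. P (b1 # b2 # b3 # xs)) \<le> 1"
proof (intro mu_cross2 p notI)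
  fix xs ys assume "length xs = N" "length ys = N" "P (a1 # a2 # a3 # xs)" "P (b1 # b2 # b3 # ys)"
    "disj2 xs ys"
  with P c n intersecting[of "a1 # a2 # a3 # xs" "b1 # b2 # b3 # ys" "c1 # c2 # c3 # replicate N True"]
  show False by (simp add: disj3_replicate_True)
qed

lemma reflect2:
  assumes n: "n = Suc (Suc N)" and p: "0 \<le> p" "p \<le> 1/2"
    and hit: "\<And>xs. length xs = N \<Longrightarrow> P (a1 # a2 # xs) \<Longrightarrow> hit 1 t xs"
  shows "(1 - p) ^ t * mu p N (\<lambda>xs. P (a1 # a2 # xs)) \<le> p ^ t * mu (1 - p) N (\<lambda>xs. P (a1 # a2 # xs))"
  using upclosed n hit by (intro mu_hit_reflect p upclosed_Cons) auto

lemma reflect3: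
  assumes n: "n = Suc (Suc (Suc N))" and p: "0 \<le> p" "p \<le> 1/2"
    and hit: "\<And>xs. length xs = N \<Longrightarrow> P (a1 # a2 # a3 # xs) \<Longrightarrow> hit 1 t xs"
  shows "(1 - p) ^ t * mu p N (\<lambda>xs. P (a1 # a2 # a3 # xs))
    \<le> p ^ t * mu (1 - p) N (\<lambda>xs. P (a1 # a2 # a3 # xs))"
  using upclosed n hit by (intro mu_hit_reflect p upclosed_Cons) auto

lemma sub2:
  assumes "n = Suc (Suc N)" "0 \<le> p" "p \<le> 1" "\<And>xs. length xs = N \<Longrightarrow> dom 0 (a1 # a2 # xs) (b1 # b2 # xs)"
  shows "mu p N (\<lambda>xs. P (a1 # a2 # xs)) \<le> mu p N (\<lambda>xs. P (b1 # b2 # xs))"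
  using assms dom_closed[of "a1 # a2 # _" "b1 # b2 # _"] by (intro mu_mono) auto

lemma sub3:
  assumes "n = Suc (Suc (Suc N))" "0 \<le> p" "p \<le> 1"
    "\<And>xs. length xs = N \<Longrightarrow> dom 0 (a1 # a2 # a3 # xs) (b1 # b2 # b3 # xs)"
  shows "mu p N (\<lambda>xs. P (a1 # a2 # a3 # xs)) \<le> mu p N (\<lambda>xs. P (b1 # b2 # b3 # xs))"
  using assms dom_closed[of "a1 # a2 # a3 # _" "b1 # b2 # b3 # _"] by (intro mu_mono) auto

lemma drop_first': "n = Suc N \<Longrightarrow> P (False # replicate N True)"
  using drop_first by simp

text \<open>Filling all free positions with \<open>True\<close> dominates every other filling. This
  drives the case distinctions on small missing sets.\<close>

lemma empty_or_full:
  assumes "n = length as + N"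
  shows "(\<forall>xs. length xs = N \<longrightarrow> \<not> P (as @ xs)) \<or> P (as @ replicate N True)"
proof -
  have "dom 0 (as @ xs) (as @ replicate N True)" if "length xs = N" for xs
    using that by (induction as) auto
  then show ?thesis using dom_closed assms by (metis length_append)
qed

text \<open>If the link of \<open>True, False\<close> is large at p, reflection makes
  \<open>y\<close> large, and cross-intersection then lowers \<open>x True True\<close>. In both
  cases the surplus over p^2 carries the factor 2p - q, which is nonpositive exactly for p <=
  1/3.\<close>

lemma mu_le_square:
  assumes n: "n = Suc (Suc N)" and p: "0 < p" "p \<le> 1/3"
  shows "mu p n P \<le> p\<^sup>2"
proof -
  define q where "q = 1 - p"
  define x where "x a b = mu p N (\<lambda>xs. P (a # b # xs))" for a b
  define y where "y = mu q N (\<lambda>xs. P (True # False # xs))"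
  have pq: "0 \<le> p" "p \<le> 1" "p \<le> 1/2" "0 < q" "2 * p \<le> q" using p by (auto simp: q_def)
  have drop1: "P (False # True # replicate N True)" using drop_first'[OF n] by simp
  have total: "mu p n P = p\<^sup>2 * x True True + p * q * (x True False + x False True) + q\<^sup>2 * x False False"
    by (simp add: n x_def q_def power2_eq_square algebra_simps)
  have cross: "x True True + y \<le> 1"
    unfolding x_def y_def q_def by (rule cross2[OF n pq(1,2) drop1]) auto
  have le: "x False True \<le> x True False" "x False False \<le> x True False" "0 \<le> x True False"
    unfolding x_def by (intro sub2[OF n] mu_nonneg pq; simp)+
  have pow: "p\<^sup>2 * x True True \<le> p\<^sup>2 * (1 - y)" using cross by (intro mult_left_mono) auto
  consider "\<And>xs. length xs = N \<Longrightarrow> \<not> P (False # False # xs)" | "P (False # False # replicate N True)"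
    using empty_or_full[of "[False, False]" N] n by auto
  then show ?thesis
  proof cases
    case 1
    have "x False False = 0" unfolding x_def using 1 by (rule mu_eq_0)
    \<comment> \<open>Pattern of all hitting claims below: \<open>no_cover2\<close> or
      \<open>no_cover3\<close> bounds the misses of three members on some prefix from above, while a
      walk missing the line has too many misses there. Here two copies of the member are combined
      with [n] - {1}; the 3 counts the misses in the two fixed positions.\<close>
    have "hit 1 2 xs" if xs: "length xs = N" "P (True # False # xs)" for xs
    proof (rule ccontr)
      assume h: "\<not> hit 1 2 xs"
      obtain m where "m \<le> N" "3 + 2 * falses xs m < m + 2"
        using no_cover2[OF n _ _ _ xs(2) xs(2) drop1] xs by auto
      with not_hit_falses[OF h, of m] xs show False by simp
    qed
    from reflect2[OF n pq(1,3) this]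
    have "q\<^sup>2 * x True False \<le> p\<^sup>2 * y" unfolding x_def y_def q_def by simp
    moreover have "p * q * x False True \<le> p * q * x True False"
      using le pq by (intro mult_left_mono) auto
    moreover have "q * (2 * p - q) * x True False \<le> 0"
      using pq le by (intro mult_nonpos_nonneg mult_nonneg_nonpos) auto
    ultimately show ?thesis using pow \<open>x False False = 0\<close>
      by (simp add: total algebra_simps power2_eq_square)
  next
    case 2
    have "hit 1 3 xs" if xs: "length xs = N" "P (True # False # xs)" for xs
    proof (rule ccontr)
      assume h: "\<not> hit 1 3 xs"
      obtain m where "m \<le> N" "4 + 2 * falses xs m < m + 2"
        using no_cover2[OF n _ _ _ xs(2) xs(2) 2] xs by auto
      with not_hit_falses[OF h, of m] xs show False by simp
    qed
    from reflect2[OF n pq(1,3) this]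
    have r: "q ^ 3 * x True False \<le> p ^ 3 * y" unfolding x_def y_def q_def by simp
    \<comment> \<open>All links other than \<open>True, True\<close> are bounded by that of
      \<open>True, False\<close>. The factor p turns the term in \<open>y\<close> into p^3
      \<open>y\<close>, as needed for \<open>r\<close>.\<close>
    have "p * mu p n P \<le> p * (p\<^sup>2 * (1 - y) + p * q * (x True False + x True False) + q\<^sup>2 * x True False)"
      unfolding total using pow le pq by (intro mult_left_mono[of _ _ p] add_mono[OF add_mono[OF pow]] mult_left_mono) auto
    also have "\<dots> \<le> p ^ 3 - q ^ 3 * x True False + p * (p * q * (x True False + x True False) + q\<^sup>2 * x True False)"
      using r by (simp add: algebra_simps power2_eq_square power3_eq_cube)
    also have "\<dots> = p ^ 3 + (2 * p - q) * q * (p + q) * x True False"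
      by (simp add: algebra_simps power2_eq_square power3_eq_cube)
    also have "\<dots> \<le> p ^ 3" using pq le by (simp add: mult_nonpos_nonneg)
    finally have "p * mu p n P \<le> p * p\<^sup>2" by (simp add: power2_eq_square power3_eq_cube)
    then show ?thesis using p by simp
  qed
qed

end

section \<open>Estimates for the hitting probability\<close>

text \<open>At p = 1/2 the root is (sqrt 5 - 1)/2 = 0.618..., hence 62/100. The identity q (1 + s +
  s^2) = 1 serves to make later inequalities homogeneous in q, which leaves polynomials in s
  alone.\<close>

lemma hit_root_bounds:
  fixes p q s :: real
  assumes "q = 1 - p" "1/3 \<le> p" "p \<le> 1/2" "0 \<le> s" "q * (s\<^sup>2 + s) = p"
  shows "q * (1 + s + s\<^sup>2) = 1" "s\<^sup>2 + s \<le> 1" "s \<le> 62/100" "0 < q" "0 < s"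
proof -
  show "q * (1 + s + s\<^sup>2) = 1" using assms(1,5) by (simp add: algebra_simps)
  show q: "0 < q" using assms by simp
  have "q * (s\<^sup>2 + s) \<le> q * 1" using assms by simp
  then show 1: "s\<^sup>2 + s \<le> 1" using q by (subst (asm) mult_le_cancel_left_pos)
  show "s \<le> 62/100"
  proof (rule ccontr)
    assume "\<not> s \<le> 62/100"
    then have "62/100 * (62/100) \<le> s * s" "62/100 < s" using mult_mono[of "62/100" s "62/100" s] by simp_all
    with 1 show False by (simp add: power2_eq_square)
  qed
  show "0 < s" using assms by (cases "s = 0") auto
qed

text \<open>For p = 414/1000 the root is about 0.4780. This value of p is the threshold that
  separates two arguments in the case without [n] - {1,2}.\<close>

lemma hit_root_lower:
  fixes p q s :: real
  assumes "q = 1 - p" "414/1000 \<le> p" "p \<le> 1/2" "0 \<le> s" "q * (s\<^sup>2 + s) = p"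
  shows "4779/10000 \<le> s"
proof (rule ccontr)
  assume "\<not> ?thesis"
  then have "s * s \<le> 4779/10000 * (4779/10000)" "s < 4779/10000"
    using assms(4) mult_mono[of s "4779/10000" s "4779/10000"] by simp_all
  then have "s\<^sup>2 + s \<le> 7063/10000" by (simp add: power2_eq_square)
  then have "q * (s\<^sup>2 + s) \<le> q * (7063/10000)" using assms by (intro mult_left_mono) auto
  then show False using assms by simp
qed

lemma square_hit_root_le:
  fixes p q s :: real
  assumes "q = 1 - p" "414/1000 \<le> p" "p \<le> 1/2" "0 \<le> s" "q * (s\<^sup>2 + s) = p"
  shows "s\<^sup>2 \<le> 3 * p - 1"
proof -
  have b: "q * (1 + s + s\<^sup>2) = 1" "s\<^sup>2 + s \<le> 1" "s \<le> 62/100" "0 < q" "0 < s"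
    using hit_root_bounds[of q p s] assms by auto
  have l: "4779/10000 \<le> s" using hit_root_lower assms by blast
  \<comment> \<open>Below s = 1/2 the first summand is negative, but at least -0.0442. The second is
    at least 0.22 * 1/4, since s^2 + s <= 3/4 there.\<close>
  have E: "0 \<le> (2 * s - 1) + s\<^sup>2 * (1 - (s\<^sup>2 + s))"
  proof (cases "1/2 \<le> s")
    case True
    then show ?thesis using b by simp
  next
    case False
    have "s * s \<le> 1/2 * (1/2)" using False b by (intro mult_mono) auto
    moreover have "4779/10000 * (4779/10000) \<le> s * s" using l by (intro mult_mono) auto
    ultimately have "22/100 * (1/4) \<le> s\<^sup>2 * (1 - (s\<^sup>2 + s))"
      using False by (intro mult_mono) (auto simp: power2_eq_square)
    then show ?thesis using l by simp
  qed
  have "3 * p - 1 - s\<^sup>2 = 3 * (q * (s\<^sup>2 + s)) - (1 + s\<^sup>2) * (q * (1 + s + s\<^sup>2))"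
    using assms b by simp
  also have "\<dots> = q * ((2 * s - 1) + s\<^sup>2 * (1 - (s\<^sup>2 + s)))"
    by (simp add: algebra_simps power2_eq_square)
  also have "\<dots> \<ge> 0" using E b by simp
  finally show ?thesis by simp
qed

text \<open>The polynomial is s + s^2 (3 - h(s)) - 1 with h increasing. On an interval [a, b] it is
  bounded below by inserting a for s and h(b) for h(s); three short intervals make this crude bound
  sufficient.\<close>

lemma hit_root_poly1:
  fixes s :: real
  assumes "4779/10000 \<le> s" "s \<le> 62/100"
  shows "0 \<le> - 1 + s + 3 * s\<^sup>2 - 2 * s ^ 4 - s ^ 5 - s ^ 7 - s ^ 8 - s ^ 9"
proof -
  have aux: "0 \<le> - 1 + s + 3 * s\<^sup>2 - 2 * s ^ 4 - s ^ 5 - s ^ 7 - s ^ 8 - s ^ 9"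
    if ab: "a \<le> s" "s \<le> b" "0 \<le> a"
      and c: "2 * b\<^sup>2 + b ^ 3 + b ^ 5 + b ^ 6 + b ^ 7 \<le> 3"
      "1 \<le> a + a\<^sup>2 * (3 - (2 * b\<^sup>2 + b ^ 3 + b ^ 5 + b ^ 6 + b ^ 7))" for a b :: real
  proof -
    let ?h = "\<lambda>b. 2 * b\<^sup>2 + b ^ 3 + b ^ 5 + b ^ 6 + b ^ 7"
    have h: "?h s \<le> ?h b" using ab by (intro add_mono mult_left_mono power_mono) auto
    have "1 \<le> a + a\<^sup>2 * (3 - ?h b)" by (fact c(2))
    also have "\<dots> \<le> s + s\<^sup>2 * (3 - ?h s)"
      using ab c(1) h by (intro add_mono mult_mono power_mono) auto
    finally show ?thesis by (simp add: algebra_simps eval_nat_numeral)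
  qed
  consider "s \<le> 1/2" | "1/2 \<le> s" "s \<le> 55/100" | "55/100 \<le> s" by linarith
  then show ?thesis
  proof cases
    case 1
    then show ?thesis using assms by (intro aux[of "4779/10000" "1/2"]) (auto simp: eval_nat_numeral)
  next
    case 2
    then show ?thesis by (intro aux[of "1/2" "55/100"]) (auto simp: eval_nat_numeral)
  next
    case 3
    then show ?thesis using assms by (intro aux[of "55/100" "62/100"]) (auto simp: eval_nat_numeral)
  qed
qed

lemma hit_root_ineq1:
  fixes p q s :: real
  assumes "q = 1 - p" "414/1000 \<le> p" "p \<le> 1/2" "0 \<le> s" "q * (s\<^sup>2 + s) = p"
  shows "p * (1 + s\<^sup>2) + q * s ^ 8 \<le> 3 * p\<^sup>2"
proof -
  let ?w = "1 + s + s\<^sup>2"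
  have b: "q * ?w = 1" "s \<le> 62/100" "0 < q" "0 < s"
    using hit_root_bounds[of q p s] assms by auto
  have "3 * p\<^sup>2 - (p * (1 + s\<^sup>2) + q * s ^ 8)
      = 3 * (q * (s\<^sup>2 + s))\<^sup>2 - (q * (s\<^sup>2 + s) * (1 + s\<^sup>2) + q * s ^ 8) * (q * ?w)"
    unfolding assms(5) b(1) by simp
  also have "\<dots> = q\<^sup>2 * s * (- 1 + s + 3 * s\<^sup>2 - 2 * s ^ 4 - s ^ 5 - s ^ 7 - s ^ 8 - s ^ 9)"
    by (simp add: algebra_simps eval_nat_numeral)
  also have "\<dots> \<ge> 0" using hit_root_poly1[OF hit_root_lower[OF assms] b(2)] b by simp
  finally show ?thesis by simp
qed

text \<open>The three estimates close the three subcases of the case in which [n] - {1,2} is a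
  member.\<close>

lemma hit_root_ineq2:
  fixes p q s :: real
  assumes "q = 1 - p" "1/3 \<le> p" "p \<le> 1/2" "0 \<le> s" "q * (s\<^sup>2 + s) = p"
  shows "p * s ^ 4 + q * s ^ 7 \<le> p ^ 3" "2 * p * s\<^sup>2 + q * s ^ 5 \<le> 4 * p ^ 3" "q * s ^ 5 \<le> p ^ 3"
proof -
  define w where "w = 1 + s + s\<^sup>2"
  have b: "q * w = 1" "s\<^sup>2 + s \<le> 1" "s \<le> 62/100" "0 < q" "0 < s"
    using hit_root_bounds[OF assms] by (auto simp: w_def)
  have ss: "s\<^sup>2 \<le> 62/100 * s" using b by (simp add: power2_eq_square)
  have w0: "0 \<le> w" using b by (simp add: w_def)
  \<comment> \<open>For s <= 62/100 the ratio w / (1 + s) = 1 + s^2 / (1 + s) stays below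
    1.24.\<close>
  have "w\<^sup>2 \<le> (124/100 * (1 + s))\<^sup>2" using ss b by (intro power_mono w0) (simp add: w_def)
  then have w: "w\<^sup>2 \<le> 15376/10000 * (1 + s)\<^sup>2" by (simp add: algebra_simps power2_eq_square)
  have ws: "w\<^sup>2 * t \<le> (15376/10000 * t) * (1 + s)\<^sup>2" if "0 \<le> t" for t
    using mult_right_mono[OF w that] by (simp add: algebra_simps)
  have q3: "0 \<le> q ^ 3 * s ^ 3" using b by simp
  have s4: "4 * s ^ 4 \<le> 3 * s\<^sup>2"
  proof -
    have "4 * s ^ 4 = 4 * (s * s) * s\<^sup>2" by (simp add: eval_nat_numeral)
    also have "\<dots> \<le> 4 * (62/100 * (62/100)) * s\<^sup>2" using b by (intro mult_right_mono mult_left_mono mult_mono) auto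
    also have "\<dots> \<le> 3 * s\<^sup>2" by (intro mult_right_mono) auto
    finally show ?thesis .
  qed
  have "p ^ 3 - (p * s ^ 4 + q * s ^ 7)
     = (q * (s\<^sup>2 + s)) ^ 3 - (q * (s\<^sup>2 + s) * s ^ 4 + q * s ^ 7) * (q * w)\<^sup>2"
    unfolding assms(5) b(1) by simp
  also have "\<dots> = q ^ 3 * s ^ 3 * ((1 + s) ^ 3 - w\<^sup>2 * (s\<^sup>2 + s ^ 3 + s ^ 4))"
    by (simp add: algebra_simps eval_nat_numeral)
  also have "\<dots> \<ge> 0"
  proof (rule mult_nonneg_nonneg[OF q3])
    have "s \<le> 1" using b by simp
    have "w\<^sup>2 \<le> 4" using b w0 power_mono[of w 2 2] by (auto simp: w_def)
    moreover have "s\<^sup>2 + s ^ 3 + s ^ 4 \<le> s + s ^ 4"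
      using mult_left_mono[OF b(2), of s] b by (simp add: eval_nat_numeral algebra_simps)
    ultimately have "w\<^sup>2 * (s\<^sup>2 + s ^ 3 + s ^ 4) \<le> 4 * (s + s ^ 4)"
      using b by (intro mult_mono) auto
    also have "\<dots> \<le> 1 + 3 * s + 3 * s\<^sup>2 + s ^ 3"
      using s4 \<open>s \<le> 1\<close> zero_le_power[OF less_imp_le[OF b(5)], of 3] by argo
    also have "\<dots> = (1 + s) ^ 3" by (simp add: algebra_simps eval_nat_numeral)
    finally show "0 \<le> (1 + s) ^ 3 - w\<^sup>2 * (s\<^sup>2 + s ^ 3 + s ^ 4)" by simp
  qed
  finally show "p * s ^ 4 + q * s ^ 7 \<le> p ^ 3" by simp
  have "4 * p ^ 3 - (2 * p * s\<^sup>2 + q * s ^ 5)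
     = 4 * (q * (s\<^sup>2 + s)) ^ 3 - (2 * (q * (s\<^sup>2 + s)) * s\<^sup>2 + q * s ^ 5) * (q * w)\<^sup>2"
    unfolding assms(5) b(1) by simp
  also have "\<dots> = q ^ 3 * s ^ 3 * (4 * (1 + s) * (1 + s)\<^sup>2 - w\<^sup>2 * (2 + 2 * s + s\<^sup>2))"
    by (simp add: algebra_simps eval_nat_numeral)
  also have "\<dots> \<ge> 0"
  proof (rule mult_nonneg_nonneg[OF q3])
    have "w\<^sup>2 * (2 + 2 * s + s\<^sup>2) \<le> (15376/10000 * (2 + 2 * s + s\<^sup>2)) * (1 + s)\<^sup>2"
      using b by (intro ws) auto
    also have "\<dots> \<le> (4 * (1 + s)) * (1 + s)\<^sup>2" using ss b by (intro mult_right_mono) auto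
    finally show "0 \<le> 4 * (1 + s) * (1 + s)\<^sup>2 - w\<^sup>2 * (2 + 2 * s + s\<^sup>2)" by simp
  qed
  finally show "2 * p * s\<^sup>2 + q * s ^ 5 \<le> 4 * p ^ 3" by simp
  have "p ^ 3 - q * s ^ 5 = (q * (s\<^sup>2 + s)) ^ 3 - q * s ^ 5 * (q * w)\<^sup>2"
    unfolding assms(5) b(1) by simp
  also have "\<dots> = q ^ 3 * s ^ 3 * ((1 + s) * (1 + s)\<^sup>2 - w\<^sup>2 * s\<^sup>2)"
    by (simp add: algebra_simps eval_nat_numeral)
  also have "\<dots> \<ge> 0"
  proof (rule mult_nonneg_nonneg[OF q3])
    have "w\<^sup>2 * s\<^sup>2 \<le> (15376/10000 * s\<^sup>2) * (1 + s)\<^sup>2" by (intro ws) auto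
    also have "\<dots> \<le> (1 + s) * (1 + s)\<^sup>2" using ss b by (intro mult_right_mono) auto
    finally show "0 \<le> (1 + s) * (1 + s)\<^sup>2 - w\<^sup>2 * s\<^sup>2" by simp
  qed
  finally show "q * s ^ 5 \<le> p ^ 3" by simp
qed

section \<open>The range from one third to one half\<close>

context stable_family
begin

text \<open>No member misses both 1 and 2, so six of the eight links on the first three points
  remain. If also no member misses 1 and 3 (while containing 2), reflection suffices. If [n] - {1,3}
  is a member, p <= 414/1000 yields even the bound p^2; for larger p the links missing two points
  are controlled by powers of s.\<close>

lemma mu_le_three_of_four_if_not_drop_12:
  assumes n: "n = Suc (Suc (Suc N))" and p: "1/3 \<le> p" "p \<le> 1/2" and q: "q = 1 - p"
    and s: "0 \<le> s" "q * (s\<^sup>2 + s) = p"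
    and FFT: "\<And>xs. length xs = N \<Longrightarrow> \<not> P (False # False # True # xs)"
  shows "mu p n P \<le> p ^ 3 + 3 * p ^ 3 * q"
proof -
  define x where "x a b c = mu p N (\<lambda>xs. P (a # b # c # xs))" for a b c
  define y where "y a b c = mu q N (\<lambda>xs. P (a # b # c # xs))" for a b c
  have pq: "0 \<le> p" "p \<le> 1" "p \<le> 1/2" "0 < q" "p \<le> q" "0 < p" "p + q = 1" using p q by auto
  have drop1: "P (False # True # True # replicate N True)" using drop_first'[OF n] by simp
  have FFF: "\<not> P (False # False # False # xs)" if "length xs = N" for xs
    using FFT[OF that] dom_closed[of "False # False # False # xs" "False # False # True # xs"] n that
    by auto
  have 0: "x False False True = 0" "x False False False = 0"
    unfolding x_def using FFT FFF by (auto intro!: mu_eq_0)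
  have total: "mu p n P = p ^ 3 * x True True True
      + p\<^sup>2 * q * (x True True False + x True False True + x False True True)
      + p * q\<^sup>2 * (x True False False + x False True False)"
    using 0 by (simp add: n x_def q power2_eq_square power3_eq_cube algebra_simps)
  have x0: "0 \<le> x a b c" for a b c unfolding x_def by (intro mu_nonneg pq)
  have le: "x True False True \<le> x True True False" "x False True True \<le> x True False True"
    "x False True False \<le> x True False False"
    unfolding x_def by (intro sub3[OF n pq(1,2)]; simp)+
  note cross = cross3[OF n pq(1,2)]
  have hit1: "hit 1 2 xs" if xs: "length xs = N" "P (True # False # False # xs)" for xs
  proof (rule ccontr)
    assume h: "\<not> hit 1 2 xs"
    obtain m where "m \<le> N" "5 + 2 * falses xs m < m + 3"
      using no_cover3[OF n _ _ _ xs(2) xs(2) drop1] xs by auto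
    with not_hit_falses[OF h, of m] xs show False by simp
  qed
  have r1: "q\<^sup>2 * x True False False \<le> p\<^sup>2 * y True False False"
    using reflect3[OF n pq(1,3) hit1] unfolding x_def y_def q by simp
  have c123: "x True True True + y True False False \<le> 1"
    unfolding x_def y_def q by (rule cross[OF drop1]) auto
  have c12: "x True True False + y True False True \<le> 1"
    unfolding x_def y_def q by (rule cross[OF drop1]) auto
  consider (empty) "\<And>xs. length xs = N \<Longrightarrow> \<not> P (False # True # False # xs)"
    | (full) "P (False # True # False # replicate N True)"
    using empty_or_full[of "[False, True, False]" N] n by auto
  then show ?thesis
  proof cases
    case empty
    have 00: "x False True False = 0" unfolding x_def using empty by (rule mu_eq_0)
    have "hit 1 1 xs" if xs: "length xs = N" "P (True # False # True # xs)" for xs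
    proof (rule ccontr)
      assume h: "\<not> hit 1 1 xs"
      obtain m where "m \<le> N" "3 + 2 * falses xs m < m + 3"
        using no_cover3[OF n _ _ _ xs(2) xs(2) drop1] xs by auto
      with not_hit_falses[OF h, of m] xs show False by simp
    qed
    from reflect3[OF n pq(1,3) this]
    have r13: "q * x True False True \<le> p * y True False True" unfolding x_def y_def q by simp
    have c12': "p * x True True False + p * y True False True \<le> p"
      using mult_left_mono[OF c12 pq(1)] by (simp add: algebra_simps)
    have "q * x True False True + p * x True False True \<le> p"
      using r13 c12' mult_left_mono[OF le(1) pq(1)] by linarith
    then have "x True False True \<le> p" using pq by (simp add: q algebra_simps)
    \<comment> \<open>Replacing \<open>x False True True\<close> by \<open>x True False True\<close>
      leaves p + (3p - 1) \<open>x True False True\<close> as a bound for p times the sum of the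
      three links. Since 3p - 1 >= 0, the bound p on that link can be inserted. For the
      three-of-four family these links have measure exactly p.\<close>
    then have "(3 * p - 1) * x True False True \<le> (3 * p - 1) * p"
      using p by (intro mult_left_mono) auto
    then have "p * (x True True False + x True False True + x False True True) \<le> p * (3 * p)"
      using r13 c12' mult_left_mono[OF le(2) pq(1)] by (simp add: q algebra_simps)
    then have A: "x True True False + x True False True + x False True True \<le> 3 * p"
      using pq by simp
    have "p * (p\<^sup>2 * x True True True) \<le> p * (p\<^sup>2 - q\<^sup>2 * x True False False)"
      using mult_left_mono[OF c123, of "p\<^sup>2"] r1 pq by (intro mult_left_mono) (auto simp: algebra_simps)
    then have B: "p ^ 3 * x True True True + p * q\<^sup>2 * x True False False \<le> p ^ 3"
      by (simp add: algebra_simps power2_eq_square power3_eq_cube)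
    have "p\<^sup>2 * q * (x True True False + x True False True + x False True True) \<le> p\<^sup>2 * q * (3 * p)"
      using A pq by (intro mult_left_mono) auto
    with B show ?thesis by (simp add: total 00 algebra_simps power2_eq_square power3_eq_cube)
  next
    case full
    have hit13: "hit 1 2 xs" if xs: "length xs = N" "P (True # False # True # xs)" for xs
    proof (rule ccontr)
      assume h: "\<not> hit 1 2 xs"
      obtain m where "m \<le> N" "4 + 2 * falses xs m < m + 3"
        using no_cover3[OF n _ _ _ xs(2) xs(2) full] xs by auto
      with not_hit_falses[OF h, of m] xs show False by simp
    qed
    have r13: "q\<^sup>2 * x True False True \<le> p\<^sup>2 * y True False True"
      using reflect3[OF n pq(1,3) hit13] unfolding x_def y_def q by simp
    have c12': "p\<^sup>2 * x True True False + p\<^sup>2 * y True False True \<le> p\<^sup>2"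
      using mult_left_mono[OF c12, of "p\<^sup>2"] by (simp add: algebra_simps)
    have c123': "p\<^sup>2 * x True True True + q\<^sup>2 * x True False True \<le> p\<^sup>2"
    proof -
      have "x True True True + y True False True \<le> 1"
        unfolding x_def y_def q by (rule cross[OF full]) auto
      from mult_left_mono[OF this, of "p\<^sup>2"] r13 show ?thesis by (simp add: algebra_simps)
    qed
    have sq: "p\<^sup>2 \<le> p ^ 3 + 3 * p ^ 3 * q"
    proof -
      have "p ^ 3 + 3 * p ^ 3 * q - p\<^sup>2 = p\<^sup>2 * q * (3 * p - 1)"
        by (simp add: q algebra_simps power2_eq_square power3_eq_cube)
      also have "\<dots> \<ge> 0" using p pq by simp
      finally show ?thesis by simp
    qed
    show ?thesis
    proof (cases "p \<le> 414/1000") \<comment> \<open>a rational just below \<open>sqrt 2 - 1\<close>, the root of \<open>2 p\<^sup>2 = q\<^sup>2\<close>\<close>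
      case True
      have "p * p \<le> 414/1000 * (414/1000)" "586/1000 * (586/1000) \<le> q * q"
        using True pq q mult_mono[of p "414/1000" p "414/1000"] mult_mono[of "586/1000" q "586/1000" q]
        by simp_all
      then have pq2: "2 * p\<^sup>2 \<le> q\<^sup>2" by (simp add: power2_eq_square)
      have "hit 1 4 xs" if xs: "length xs = N" "P (True # False # False # xs)" for xs
      proof (rule ccontr)
        assume h: "\<not> hit 1 4 xs"
        obtain m where "m \<le> N" "6 + 2 * falses xs m < m + 3"
          using no_cover3[OF n _ _ _ xs(2) xs(2) full] xs by auto
        with not_hit_falses[OF h, of m] xs show False by simp
      qed
      from reflect3[OF n pq(1,3) this]
      have r1: "q ^ 4 * x True False False \<le> p ^ 4 * y True False False"
        unfolding x_def y_def q by simp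
      have "p\<^sup>2 * (x True True False + x True False True + x False True True)
          \<le> p\<^sup>2 + (2 * p\<^sup>2 - q\<^sup>2) * x True False True"
        using r13 c12' mult_left_mono[OF le(2), of "p\<^sup>2"] by (simp add: algebra_simps)
      also have "\<dots> \<le> p\<^sup>2" using pq2 x0 by (simp add: mult_nonpos_nonneg)
      finally have A: "q * (p\<^sup>2 * (x True True False + x True False True + x False True True)) \<le> q * p\<^sup>2"
        using pq by (intro mult_left_mono) auto
      have "p * (p ^ 3 * x True True True + p * q\<^sup>2 * (x True False False + x False True False))
        \<le> p ^ 4 * x True True True + 2 * p\<^sup>2 * q\<^sup>2 * x True False False"
        using mult_left_mono[OF le(3), of "p\<^sup>2 * q\<^sup>2"] pq
        by (simp add: algebra_simps eval_nat_numeral)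
      also have "\<dots> \<le> p ^ 4 + (2 * p\<^sup>2 - q\<^sup>2) * q\<^sup>2 * x True False False"
        using r1 mult_left_mono[OF c123, of "p ^ 4"] pq by (simp add: algebra_simps eval_nat_numeral)
      also have "\<dots> \<le> p * p ^ 3" using pq2 x0 by (simp add: mult_nonpos_nonneg eval_nat_numeral)
      finally have B: "p ^ 3 * x True True True + p * q\<^sup>2 * (x True False False + x False True False) \<le> p ^ 3"
        using pq by simp
      have "mu p n P \<le> p ^ 3 + q * p\<^sup>2" using A B by (simp add: total algebra_simps)
      also have "\<dots> = p\<^sup>2" by (simp add: q algebra_simps eval_nat_numeral)
      finally show ?thesis using sq by simp
    next
      case False
      then have p414: "414/1000 \<le> p" by simp
      note alpha = mu_hit_le[OF pq(1,2) s(1) s(2)[unfolded q]]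
      show ?thesis
      \<comment> \<open>Win-win: either every such walk meets y = 2x + 3, so that this link is
        small, or a member that misses the line has so many right steps that it forces other links
        to meet high lines.\<close>
      proof (cases "\<forall>xs. length xs = N \<longrightarrow> P (True # False # False # xs) \<longrightarrow> hit 2 3 xs")
        case True
        have x1: "x True False False \<le> s ^ 3" unfolding x_def using True by (intro alpha) auto
        have "hit 2 4 xs" if xs: "length xs = N" "P (False # True # False # xs)" for xs
        proof (rule ccontr)
          assume h: "\<not> hit 2 4 xs"
          \<comment> \<open>The point 2 is moved to 1, so that \<open>xs\<close> can be used with
            two misses in each of three members: six misses on the fixed positions.\<close>
          have xs': "P (True # False # False # xs)"
            using dom_closed[OF _ _ xs(2)] xs n by auto
          obtain m where "m \<le> N" "6 + 3 * falses xs m < m + 3"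
            using no_cover3[OF n _ _ _ xs' xs' xs(2)] xs by auto
          with not_hit_falses[OF h, of m] xs show False by simp
        qed
        then have x2: "x False True False \<le> s ^ 4" unfolding x_def by (intro alpha) auto
        have "p * q\<^sup>2 * (x True False False + x False True False) \<le> p * q\<^sup>2 * (s ^ 3 + s ^ 4)"
          using x1 x2 pq by (intro mult_left_mono add_mono) auto
        \<comment> \<open>The equation of the root applies to s^3 + s^4, and what remains is p^2 q
          s^2. Together with p^2 from the other links, \<open>square_hit_root_le\<close> then gives
          exactly the target.\<close>
        also have "\<dots> = p * q * s\<^sup>2 * (q * (s\<^sup>2 + s))" by (simp add: algebra_simps eval_nat_numeral)
        also have "\<dots> = p\<^sup>2 * q * s\<^sup>2" using s by (simp add: power2_eq_square)
        also have "\<dots> \<le> p\<^sup>2 * q * (3 * p - 1)"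
          using square_hit_root_le[OF q p414 p(2) s] pq by (intro mult_left_mono) auto
        finally have A: "p * q\<^sup>2 * (x True False False + x False True False) \<le> p\<^sup>2 * q * (3 * p - 1)" .
        have B1: "p ^ 3 * x True True True \<le> p * (p\<^sup>2 - q\<^sup>2 * x True False True)"
          using mult_left_mono[OF c123' pq(1)] by (simp add: algebra_simps eval_nat_numeral)
        have "p\<^sup>2 * x True True False + p\<^sup>2 * x True False True + p\<^sup>2 * x False True True
          \<le> p\<^sup>2 - q\<^sup>2 * x True False True + 2 * p\<^sup>2 * x True False True"
          using c12' r13 mult_left_mono[OF le(2), of "p\<^sup>2"] by (simp add: algebra_simps)
        then have "q * (p\<^sup>2 * x True True False + p\<^sup>2 * x True False True + p\<^sup>2 * x False True True)
          \<le> q * (p\<^sup>2 - q\<^sup>2 * x True False True + 2 * p\<^sup>2 * x True False True)"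
          using pq by (intro mult_left_mono) auto
        with B1 have "p ^ 3 * x True True True
          + p\<^sup>2 * q * (x True True False + x True False True + x False True True)
          \<le> (p + q) * (p\<^sup>2 - q\<^sup>2 * x True False True) + 2 * p\<^sup>2 * q * x True False True"
          by (simp add: algebra_simps)
        also have "\<dots> = p\<^sup>2 + q * (2 * p\<^sup>2 - q) * x True False True"
          unfolding pq(7) by (simp add: algebra_simps power2_eq_square)
        also have "\<dots> \<le> p\<^sup>2"
        proof -
          have "p * p \<le> 1/4" using pq mult_mono[of p "1/2" p "1/2"] by simp
          then have "2 * p\<^sup>2 \<le> q" using pq by (simp add: power2_eq_square)
          then show ?thesis using pq x0 by (simp add: mult_nonpos_nonneg mult_nonneg_nonpos)
        qed
        finally have "mu p n P \<le> p\<^sup>2 + p\<^sup>2 * q * (3 * p - 1)" using A by (simp add: total)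
        also have "\<dots> = p ^ 3 + 3 * p ^ 3 * q"
          by (simp add: q algebra_simps eval_nat_numeral)
        finally show ?thesis .
      next
        case False
        then obtain w where w: "length w = N" "P (True # False # False # w)" "\<not> hit 2 3 w" by blast
        have "hit 2 2 xs" if xs: "length xs = N" "P (False # True # True # xs)" for xs
        proof (rule ccontr)
          assume h: "\<not> hit 2 2 xs"
          obtain m where "m \<le> N" "4 + falses w m + 2 * falses xs m < m + 3"
            using no_cover3[OF n _ _ _ w(2) xs(2) xs(2)] xs w by auto
          with not_hit_falses[OF h, of m] not_hit_falses[OF w(3), of m] xs w show False by simp
        qed
        then have x23: "x False True True \<le> s\<^sup>2" unfolding x_def by (intro alpha) auto
        \<comment> \<open>Two copies of the witness \<open>w\<close> miss about 2m/3 of the first m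
          positions, so the third walk must do with very few right steps; hence the high
          line.\<close>
        have "hit 2 8 xs" if xs: "length xs = N" "P (False # True # False # xs)" for xs
        proof (rule ccontr)
          assume h: "\<not> hit 2 8 xs"
          obtain m where "m \<le> N" "6 + 2 * falses w m + falses xs m < m + 3"
            using no_cover3[OF n _ _ _ w(2) w(2) xs(2)] xs w by auto
          with not_hit_falses[OF h, of m] not_hit_falses[OF w(3), of m] xs w show False by simp
        qed
        then have x2: "x False True False \<le> s ^ 8" unfolding x_def by (intro alpha) auto
        have A: "p ^ 3 * x True True True + p\<^sup>2 * q * x True False True \<le> p ^ 3"
        proof -
          have "p * q * p * x True False True \<le> p * q * q * x True False True"
            using pq x0 by (intro mult_right_mono mult_left_mono) auto
          then show ?thesis using mult_left_mono[OF c123' pq(1)]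
            by (simp add: algebra_simps eval_nat_numeral)
        qed
        have "x True True False + y True False False \<le> 1"
          unfolding x_def y_def q by (rule cross[OF drop1]) auto
        from mult_left_mono[OF this, of "p\<^sup>2"] r1
        have "p\<^sup>2 * x True True False + q * q * x True False False \<le> p\<^sup>2"
          by (simp add: algebra_simps power2_eq_square)
        moreover have "p * q * x True False False \<le> q * q * x True False False"
          using pq x0 by (intro mult_right_mono) auto
        ultimately have "p\<^sup>2 * x True True False + p * q * x True False False \<le> p\<^sup>2" by linarith
        then have B: "q * (p\<^sup>2 * x True True False + p * q * x True False False) \<le> q * p\<^sup>2"
          using pq by (intro mult_left_mono) auto
        have "p\<^sup>2 * q * x False True True \<le> p\<^sup>2 * q * s\<^sup>2"
          using x23 pq by (intro mult_left_mono) auto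
        moreover have "p * q\<^sup>2 * x False True False \<le> p * q\<^sup>2 * s ^ 8"
          using x2 pq by (intro mult_left_mono) auto
        ultimately have "mu p n P \<le> p ^ 3 + p * q * (p * (1 + s\<^sup>2) + q * s ^ 8)"
          using A B by (simp add: total algebra_simps power2_eq_square)
        also have "\<dots> \<le> p ^ 3 + p * q * (3 * p\<^sup>2)"
          using hit_root_ineq1[OF q p414 p(2) s] pq by (intro add_mono mult_left_mono) auto
        finally show ?thesis by (simp add: algebra_simps eval_nat_numeral)
      qed
    qed
  qed
qed

text \<open>Pairing with [n] - {1,2} bounds \<open>x True True\<close> by p, which uses up p^3 of
  the target. The remaining three links together have the budget 3 p^3 q.\<close>

lemma mu_le_three_of_four_if_drop_12:
  assumes n: "n = Suc (Suc (Suc (Suc M)))" and p: "1/3 \<le> p" "p \<le> 1/2" and q: "q = 1 - p"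
    and s: "0 \<le> s" "q * (s\<^sup>2 + s) = p"
    and full: "P (False # False # replicate (Suc (Suc M)) True)"
  shows "mu p n P \<le> p ^ 3 + 3 * p ^ 3 * q"
proof -
  define N where "N = Suc (Suc M)"
  have n2: "n = Suc (Suc N)" using n N_def by simp
  note full = full[folded N_def]
  define x where "x a b = mu p N (\<lambda>xs. P (a # b # xs))" for a b
  define y where "y a b = mu q N (\<lambda>xs. P (a # b # xs))" for a b
  have pq: "0 \<le> p" "p \<le> 1" "p \<le> 1/2" "0 < q" "p \<le> q" "0 < p" "p + q = 1" using p q by auto
  have total: "mu p n P = p\<^sup>2 * x True True + p * q * (x True False + x False True) + q\<^sup>2 * x False False"
    by (simp add: n2 x_def q power2_eq_square algebra_simps)
  have x0: "0 \<le> x a b" for a b unfolding x_def by (intro mu_nonneg pq)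
  have le: "x True False \<le> x True True"
    unfolding x_def by (intro sub2[OF n2 pq(1,2)]; simp)+
  note alpha = mu_hit_le[OF pq(1,2) s(1) s(2)[unfolded q]]
  have "hit 1 1 xs" if xs: "length xs = N" "P (True # True # xs)" for xs
  proof (rule ccontr)
    assume h: "\<not> hit 1 1 xs"
    obtain m where "m \<le> N" "2 + 2 * falses xs m < m + 2"
      using no_cover2[OF n2 _ _ _ xs(2) xs(2) full] xs by auto
    with not_hit_falses[OF h, of m] xs show False by simp
  qed
  from reflect2[OF n2 pq(1,3) this]
  have r11: "q * x True True \<le> p * y True True" unfolding x_def y_def q by simp
  have "x True True + y True True \<le> 1"
    unfolding x_def y_def q by (rule cross2[OF n2 pq(1,2) full]) auto
  from mult_left_mono[OF this pq(1)] r11 have "(p + q) * x True True \<le> p"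
    by (simp add: algebra_simps)
  then have x11: "p\<^sup>2 * x True True \<le> p ^ 3" unfolding pq(7)
    using mult_left_mono[of "x True True" p "p\<^sup>2"] by (simp add: eval_nat_numeral)
  have reduce: ?thesis if "p * (x True False + x False True) + q * x False False \<le> 3 * p ^ 3"
    using x11 mult_left_mono[OF that, of q] pq by (simp add: total algebra_simps power2_eq_square)
  show ?thesis
  \<comment> \<open>The same alternative as before, now for the line y = 2x + 2: a member that
    misses it forces the links missing 1 to be tiny.\<close>
  proof (cases "\<forall>xs. length xs = N \<longrightarrow> P (True # False # xs) \<longrightarrow> hit 2 2 xs")
    case False
    then obtain w where w: "length w = N" "P (True # False # w)" "\<not> hit 2 2 w" by blast
    have "hit 2 4 xs" if xs: "length xs = N" "P (False # True # xs)" for xs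
    proof (rule ccontr)
      assume h: "\<not> hit 2 4 xs"
      obtain m where "m \<le> N" "3 + 2 * falses w m + falses xs m < m + 2"
        using no_cover2[OF n2 _ _ _ w(2) w(2) xs(2)] xs w by auto
      with not_hit_falses[OF h, of m] not_hit_falses[OF w(3), of m] xs w show False by simp
    qed
    then have x01: "x False True \<le> s ^ 4" unfolding x_def by (intro alpha) auto
    have "hit 2 7 xs" if xs: "length xs = N" "P (False # False # xs)" for xs
    proof (rule ccontr)
      assume h: "\<not> hit 2 7 xs"
      obtain m where "m \<le> N" "4 + 2 * falses w m + falses xs m < m + 2"
        using no_cover2[OF n2 _ _ _ w(2) w(2) xs(2)] xs w by auto
      with not_hit_falses[OF h, of m] not_hit_falses[OF w(3), of m] xs w show False by simp
    qed
    then have x00: "x False False \<le> s ^ 7" unfolding x_def by (intro alpha) auto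
    have "hit 1 3 xs" if xs: "length xs = N" "P (True # False # xs)" for xs
    proof (rule ccontr)
      assume h: "\<not> hit 1 3 xs"
      obtain m where "m \<le> N" "4 + 2 * falses xs m < m + 2"
        using no_cover2[OF n2 _ _ _ xs(2) xs(2) full] xs by auto
      with not_hit_falses[OF h, of m] xs show False by simp
    qed
    from reflect2[OF n2 pq(1,3) this]
    have r10: "q ^ 3 * x True False \<le> p ^ 3 * y True False" unfolding x_def y_def q by simp
    have "x True True + y True False \<le> 1"
      unfolding x_def y_def q by (rule cross2[OF n2 pq(1,2) full]) auto
    then have "p ^ 3 * (x True False + y True False) \<le> p ^ 3 * 1"
      using le pq by (intro mult_left_mono) auto
    with r10 have "(p ^ 3 + q ^ 3) * x True False \<le> p ^ 3" by (simp add: algebra_simps)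
    moreover have "p * x True False \<le> 2 * (p ^ 3 + q ^ 3) * x True False"
    proof (intro mult_right_mono x0)
      have "2 * (p ^ 3 + q ^ 3) - p = (1 - 2 * p) * (2 - 3 * p)"
        by (simp add: q algebra_simps eval_nat_numeral)
      also have "\<dots> \<ge> 0" using p by simp
      finally show "p \<le> 2 * (p ^ 3 + q ^ 3)" by simp
    qed
    moreover have "p * x False True \<le> p * s ^ 4" "q * x False False \<le> q * s ^ 7"
      using x01 x00 pq by (auto intro: mult_left_mono)
    ultimately show ?thesis
      using hit_root_ineq2(1)[OF q p s] by (intro reduce) (simp add: algebra_simps)
  next
    case True
    have "hit 2 5 xs" if xs: "length xs = N" "P (False # False # xs)" for xs
    proof (rule ccontr)
      assume h: "\<not> hit 2 5 xs"
      obtain m where "m \<le> N" "6 + 3 * falses xs m < m + 2"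
        using no_cover2[OF n2 _ _ _ xs(2) xs(2) xs(2)] xs by auto
      with not_hit_falses[OF h, of m] xs show False by simp
    qed
    \<comment> \<open>All three members may be copies of one set, which misses both fixed points:
      this is why the slope is 2.\<close>
    then have "x False False \<le> s ^ 5" unfolding x_def by (intro alpha) auto
    then have x00: "q * x False False \<le> q * s ^ 5" using pq by (intro mult_left_mono) auto
    have H10: "hit 2 2 xs" if "length xs = N" "P (True # False # xs)" for xs
      using True that by blast
    have H01: "hit 2 2 xs" if "length xs = N" "P (False # True # xs)" for xs
      using H10[OF that(1)] dom_closed[OF _ _ that(2), of "True # False # xs"] that n2 by auto
    \<comment> \<open>Bounding both links by s^2 would waste their overlap. Two further letters
      isolate the part after \<open>True, True\<close>, where the line is already met; there the two
      links are compared with each other.\<close>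
    define z where "z a b c d = mu p M (\<lambda>xs. P (a # b # c # d # xs))" for a b c d
    have split: "x a b = p\<^sup>2 * z a b True True
      + p * q * (z a b True False + z a b False True) + q\<^sup>2 * z a b False False" for a b
      unfolding x_def z_def N_def by (simp add: q power2_eq_square algebra_simps)
    have z0: "0 \<le> z a b c d" "z a b c d \<le> 1" for a b c d
      unfolding z_def by (intro mu_nonneg mu_le_1 pq)+
    consider (empty) "\<And>xs. length xs = M \<Longrightarrow> \<not> P (True # False # True # False # xs)"
      | (full2) "P (True # False # True # False # replicate M True)"
      using empty_or_full[of "[True, False, True, False]" M] n by auto
    then show ?thesis
    proof cases
      case empty
      have "z a b c d = 0" if "\<not> (c \<and> d)" "\<not> (a \<and> b)" for a b c d
        unfolding z_def
      proof (intro mu_eq_0 notI)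
        fix xs assume xs: "length xs = M" "P (a # b # c # d # xs)"
        have "dom 0 (a # b # c # d # xs) (True # False # True # False # xs)"
          using that by (cases a; cases b; cases c; cases d; simp)
        with dom_closed[OF _ this] empty xs n show False by simp
      qed
      then have "x a b \<le> p\<^sup>2" if "\<not> (a \<and> b)" for a b
        unfolding split using that mult_left_mono[OF z0(2), of "p\<^sup>2"] by simp
      then have "p * (x True False + x False True) \<le> p * (p\<^sup>2 + p\<^sup>2)"
        using pq by (intro mult_left_mono add_mono) auto
      then show ?thesis using x00 hit_root_ineq2(3)[OF q p s]
        by (intro reduce) (simp add: eval_nat_numeral)
    next
      case full2
      have full3: "P (True # True # False # False # replicate M True)"
        by (rule dom_closed[OF _ _ full2]) (auto simp: n)
      have up: "upclosed M (\<lambda>xs. P (a # b # c # d # xs))" for a b c d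
        using upclosed n by (intro upclosed_Cons) simp
      \<comment> \<open>\<open>full3\<close> misses exactly 3 and 4 and the two prefixes miss 2 and
        1, so the links cross-intersect. The following step passes from q to p, which saves p^2 in
        the sum of both links.\<close>
      have "z True False True True + mu (1 - p) M (\<lambda>xs. P (False # True # True # True # xs)) \<le> 1"
        unfolding z_def
      proof (intro mu_cross2 pq notI)
        fix xs ys assume "length xs = M" "length ys = M" "P (True # False # True # True # xs)"
          "P (False # True # True # True # ys)" "disj2 xs ys"
        with full3 n intersecting[of "True # False # True # True # xs"
            "False # True # True # True # ys" "True # True # False # False # replicate M True"]
        show False by (simp add: disj3_replicate_True)
      qed
      moreover have "z False True True True \<le> mu (1 - p) M (\<lambda>xs. P (False # True # True # True # xs))"
        unfolding z_def using pq by (intro mu_mono_prob up) auto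
      ultimately have z11: "z True False True True + z False True True True \<le> 1" by simp
      \<comment> \<open>Two steps of the ruin recursion: after \<open>True, False\<close> or
        \<open>False, True\<close> the line is 3 away, after \<open>False, False\<close> it is 6
        away. All four outcomes would sum to (p + q s^3)^2 = s^2, and the outcome
        \<open>True, True\<close> accounts for p^2 of it.\<close>
      have rest: "p * q * (z a b True False + z a b False True) + q\<^sup>2 * z a b False False \<le> s\<^sup>2 - p\<^sup>2"
        if H: "\<And>xs. length xs = N \<Longrightarrow> P (a # b # xs) \<Longrightarrow> hit 2 2 xs" for a b
      proof -
        have "z a b True False \<le> s ^ 3" "z a b False True \<le> s ^ 3" "z a b False False \<le> s ^ 6"
          unfolding z_def
          using H[of "True # False # _"] H[of "False # True # _"] H[of "False # False # _"]
          by (intro alpha; auto simp: N_def eval_nat_numeral)+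
        then have "p * q * (z a b True False + z a b False True) + q\<^sup>2 * z a b False False
          \<le> p * q * (s ^ 3 + s ^ 3) + q\<^sup>2 * s ^ 6"
          using pq by (intro add_mono mult_left_mono) auto
        also have "\<dots> = (p + q * s ^ 3)\<^sup>2 - p\<^sup>2" by (simp add: algebra_simps eval_nat_numeral)
        also have "p + q * s ^ 3 = s + (s - 1) * (q * (s\<^sup>2 + s) - p)"
          by (simp add: q algebra_simps eval_nat_numeral)
        also have "\<dots> = s" using s by simp
        finally show ?thesis .
      qed
      have r10: "p * q * (z True False True False + z True False False True)
          + q\<^sup>2 * z True False False False \<le> s\<^sup>2 - p\<^sup>2"
        by (rule rest) (rule H10)
      have r01: "p * q * (z False True True False + z False True False True)
          + q\<^sup>2 * z False True False False \<le> s\<^sup>2 - p\<^sup>2"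
        by (rule rest) (rule H01)
      have "x True False + x False True \<le> p\<^sup>2 * (z True False True True + z False True True True)
          + 2 * (s\<^sup>2 - p\<^sup>2)"
        unfolding split using r10 r01 by (simp add: algebra_simps)
      also have "\<dots> \<le> p\<^sup>2 * 1 + 2 * (s\<^sup>2 - p\<^sup>2)" using z11 by (intro add_mono mult_left_mono) auto
      finally have "p * (x True False + x False True) \<le> p * (2 * s\<^sup>2 - p\<^sup>2)"
        using pq by (intro mult_left_mono) auto
      then show ?thesis using x00 hit_root_ineq2(2)[OF q p s]
        by (intro reduce) (simp add: algebra_simps eval_nat_numeral)
    qed
  qed
qed

lemma mu_le_three_of_four:
  assumes n: "4 \<le> n" and p: "1/3 \<le> p" "p \<le> 1/2" and q: "q = 1 - p"
  shows "mu p n P \<le> 4 * p ^ 3 * q + p ^ 4"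
proof -
  obtain M where M: "n = Suc (Suc (Suc (Suc M)))"
    using n le_Suc_ex[OF n] by (auto simp: eval_nat_numeral)
  \<comment> \<open>Square root of the discriminant of s^2 + s = p/q; s is the nonnegative
    solution.\<close>
  define r where "r = sqrt (1 + 4 * p / q)"
  define s where "s = (r - 1) / 2"
  have q0: "0 < q" using p q by simp
  have "1 \<le> r" using p q0 by (simp add: r_def)
  then have "0 \<le> s" by (simp add: s_def)
  have "r\<^sup>2 = 1 + 4 * p / q" using p q0 by (simp add: r_def)
  moreover have "r = 2 * s + 1" unfolding s_def by argo
  ultimately have "4 * (s\<^sup>2 + s) = 4 * p / q" by (simp add: power2_eq_square algebra_simps)
  then have "s\<^sup>2 + s = p / q" by argo
  then have s: "q * (s\<^sup>2 + s) = p" using q0 by simp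
  have "mu p n P \<le> p ^ 3 + 3 * p ^ 3 * q"
  proof -
    consider "\<And>xs. length xs = Suc M \<Longrightarrow> \<not> P (False # False # True # xs)"
      | "P (False # False # replicate (Suc (Suc M)) True)"
      using empty_or_full[of "[False, False, True]" "Suc M"] M by auto
    then show ?thesis
      using mu_le_three_of_four_if_not_drop_12[OF M p q \<open>0 \<le> s\<close> s] mu_le_three_of_four_if_drop_12[OF M p q \<open>0 \<le> s\<close> s]
      by cases blast+
  qed
  also have "\<dots> = 4 * p ^ 3 * q + p ^ 4" by (simp add: q algebra_simps eval_nat_numeral)
  finally show ?thesis .
qed

end

section \<open>The range from one half to two thirds\<close>

lemma powr_add_one_diff_mono:
  fixes a u w :: real
  assumes "1 \<le> a" "0 < w" "w \<le> u"
  shows "(w + 1) powr a - w powr a \<le> (u + 1) powr a - u powr a"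
proof -
  have "\<exists>y. ((\<lambda>x. (x + 1) powr a - x powr a) has_real_derivative y) (at x) \<and> 0 \<le> y"
    if "w \<le> x" for x
  proof (intro exI conjI)
    have x: "0 < x" using that assms by simp
    then show "((\<lambda>x. (x + 1) powr a - x powr a) has_real_derivative
        (a * (x + 1) powr (a - 1) - a * x powr (a - 1))) (at x)"
      by (auto intro!: derivative_eq_intros)
    have "x powr (a - 1) \<le> (x + 1) powr (a - 1)" using x assms by (intro powr_mono2) auto
    then show "0 \<le> a * (x + 1) powr (a - 1) - a * x powr (a - 1)"
      using assms by (simp add: mult_left_mono)
  qed
  then show ?thesis using DERIV_nonneg_imp_nondecreasing[OF assms(3)] by blast
qed

text \<open>Subtract v^a on both sides and put d = u - v. Both increments become (t d)^a times an
  increment of x^a over a unit interval, starting at v/d and at v/(t d). By convexity the later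
  start gives more. The cases v = 0 and d = 0 are treated apart because of the positivity and the
  division.\<close>

lemma powr_two_point:
  fixes a t u v :: real
  assumes a: "1 \<le> a" and t: "0 < t" "t \<le> 1" and uv: "0 \<le> v" "v \<le> u"
  shows "t powr a * u powr a + (1 - t powr a) * v powr a \<le> (t * u + (1 - t) * v) powr a"
proof (cases "v = 0 \<or> u = v")
  case True
  then show ?thesis using assms by (auto simp: powr_mult algebra_simps)
next
  case False
  define d where "d = u - v"
  have d: "0 < d" "0 < v" using False uv by (auto simp: d_def)
  have "(v / d + 1) powr a - (v / d) powr a \<le> (v / (t * d) + 1) powr a - (v / (t * d)) powr a"
    using a t d by (intro powr_add_one_diff_mono) (auto simp: field_simps)
  then have "(t * d) powr a * ((v / d + 1) powr a - (v / d) powr a)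
    \<le> (t * d) powr a * ((v / (t * d) + 1) powr a - (v / (t * d)) powr a)"
    by (intro mult_left_mono) auto
  moreover have "(t * d) powr a * ((v / d + 1) powr a - (v / d) powr a)
    = t powr a * (u powr a - v powr a)"
  proof -
    have "v / d + 1 = u / d" using d by (simp add: d_def field_simps)
    then show ?thesis using d t uv by (simp add: powr_mult powr_divide algebra_simps)
  qed
  moreover have "(t * d) powr a * ((v / (t * d) + 1) powr a - (v / (t * d)) powr a)
    = (t * u + (1 - t) * v) powr a - v powr a"
  proof -
    have "v / (t * d) + 1 = (t * u + (1 - t) * v) / (t * d)"
      using d t by (simp add: d_def field_simps)
    moreover have "0 \<le> t * u + (1 - t) * v" using t uv by auto
    ultimately show ?thesis using d t by (simp add: powr_divide algebra_simps)
  qed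
  ultimately show ?thesis by (simp add: algebra_simps)
qed

text \<open>Induction on the first coordinate: \<open>powr_two_point\<close> is the one-coordinate
  case, with up-closedness supplying v <= u.\<close>

lemma mu_powr_le:
  assumes a: "1 \<le> a" and p: "0 < p" "p \<le> 1" and "upclosed n P"
  shows "mu (p powr a) n P \<le> mu p n P powr a"
  using assms(4)
proof (induction n arbitrary: P)
  case 0
  then show ?case by simp
next
  case (Suc n)
  let ?u = "\<lambda>p b. mu p n (\<lambda>xs. P (b # xs))"
  have pa: "0 \<le> p powr a" "p powr a \<le> 1" using p a by (auto simp: powr_le1)
  have "mu (p powr a) (Suc n) P \<le> p powr a * ?u p True powr a + (1 - p powr a) * ?u p False powr a"
    using Suc pa by (auto intro!: add_mono mult_left_mono upclosed_Cons)
  also have "\<dots> \<le> (p * ?u p True + (1 - p) * ?u p False) powr a"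
    using p upclosed_False_True[OF Suc.prems] mu_nonneg[of p n]
    by (intro powr_two_point[OF a p(1,2)] mu_mono mu_nonneg) auto
  finally show ?case by simp
qed

lemma mu_le_prob:
  assumes p: "0 < p" "p \<le> 2/3" and "upclosed n P"
    and int: "\<And>xs ys zs. length xs = n \<Longrightarrow> length ys = n \<Longrightarrow> length zs = n \<Longrightarrow>
      P xs \<Longrightarrow> P ys \<Longrightarrow> P zs \<Longrightarrow> \<not> disj3 xs ys zs"
  shows "mu p n P \<le> p"
proof -
  \<comment> \<open>Chosen so that (2/3)^a = p; then p <= 2/3 means a >= 1.\<close>
  define a where "a = ln p / ln (2/3 :: real)"
  have l: "ln (2/3 :: real) < 0" by simp
  have "ln p \<le> ln (2/3)" using p by simp
  then have a: "1 \<le> a" using l by (simp add: a_def field_simps)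
  have pa: "(2/3) powr a = p" using p l by (simp add: powr_def a_def)
  have "mu (2/3) n P + mu (2/3) n P + mu (2/3) n P \<le> 2" by (rule mu_cross3) (rule int)
  then have 23: "mu (2/3) n P \<le> 2/3" by simp
  have "mu p n P \<le> mu (2/3) n P powr a"
    using mu_powr_le[OF a, of "2/3" n P] assms(3) by (simp add: pa)
  also have "\<dots> \<le> (2/3) powr a" using a 23 by (intro powr_mono2 mu_nonneg) auto
  finally show ?thesis by (simp add: pa)
qed

section \<open>From set families to boolean lists\<close>

definition weight :: "real \<Rightarrow> bool list \<Rightarrow> real" where
  "weight p xs = p ^ count_list xs True * (1 - p) ^ count_list xs False"

lemma finite_lists_bool: "finite {xs :: bool list. length xs = n \<and> P xs}"
  using finite_lists_length_eq[of "UNIV :: bool set" n] by (rule finite_subset[rotated]) auto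

lemma mu_eq_sum: "mu p n P = (\<Sum>xs | length xs = n \<and> P xs. weight p xs)"
proof (induction n arbitrary: P)
  case 0
  have "{xs. xs = [] \<and> P xs} = (if P [] then {[]} else {})" by auto
  then show ?case by (simp add: weight_def)
next
  case (Suc n)
  let ?S = "\<lambda>b. {xs. length xs = n \<and> P (b # xs)}"
  have "{xs. length xs = Suc n \<and> P xs} = (#) True ` ?S True \<union> (#) False ` ?S False"
  proof (intro set_eqI)
    fix xs show "xs \<in> {xs. length xs = Suc n \<and> P xs} \<longleftrightarrow> xs \<in> (#) True ` ?S True \<union> (#) False ` ?S False"
      by (cases xs; cases "hd xs") auto
  qed
  moreover have "sum (weight p) ((#) True ` ?S True \<union> (#) False ` ?S False)
    = sum (weight p) ((#) True ` ?S True) + sum (weight p) ((#) False ` ?S False)"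
    by (intro sum.union_disjoint finite_imageI finite_lists_bool) auto
  moreover have "sum (weight p) ((#) True ` ?S True) = p * sum (weight p) (?S True)"
    by (simp add: sum.reindex weight_def sum_distrib_left mult.assoc)
  moreover have "sum (weight p) ((#) False ` ?S False) = (1 - p) * sum (weight p) (?S False)"
    by (simp add: sum.reindex weight_def sum_distrib_left mult.assoc mult.left_commute)
  ultimately show ?case by (simp add: Suc)
qed

definition positions :: "bool list \<Rightarrow> nat set" where
  "positions xs = {Suc i |i. i < length xs \<and> xs ! i}"

lemma Suc_in_positions [simp]: "Suc i \<in> positions xs \<longleftrightarrow> i < length xs \<and> xs ! i"
  by (auto simp: positions_def)

lemma zero_notin_positions [simp]: "0 \<notin> positions xs"
  by (auto simp: positions_def)

lemma positions_subset: "positions xs \<subseteq> {1..length xs}"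
  by (auto simp: positions_def)

lemma positions_Nil [simp]: "positions [] = {}" by (auto simp: positions_def)

lemma positions_Cons: "positions (x # xs) = (if x then {1} else {}) \<union> Suc ` positions xs"
proof (intro set_eqI)
  fix k show "k \<in> positions (x # xs) \<longleftrightarrow> k \<in> (if x then {1} else {}) \<union> Suc ` positions xs"
    by (cases k; cases "k - 1") auto
qed

lemma finite_positions [simp]: "finite (positions xs)"
  using positions_subset finite_subset by blast

lemma card_positions: "card (positions xs) = count_list xs True"
proof (induction xs)
  case (Cons x xs)
  have "card (Suc ` positions xs) = card (positions xs)" by (simp add: card_image)
  moreover have "1 \<notin> Suc ` positions xs" by auto
  ultimately show ?case using Cons by (simp add: positions_Cons)
qed simp

lemma count_list_True_False: "count_list xs True + count_list xs False = length xs"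
  by (induction xs) auto

lemma positions_list: "G \<subseteq> {1..n} \<Longrightarrow> positions (map (\<lambda>i. Suc i \<in> G) [0..<n]) = G"
proof (intro set_eqI)
  fix k assume "G \<subseteq> {1..n}"
  then show "k \<in> positions (map (\<lambda>i. Suc i \<in> G) [0..<n]) \<longleftrightarrow> k \<in> G" by (cases k) auto
qed

lemma bij_betw_positions:
  assumes "\<F> \<subseteq> Pow {1..n}"
  shows "bij_betw positions {xs. length xs = n \<and> positions xs \<in> \<F>} \<F>"
proof (rule bij_betw_byWitness[where f' = "\<lambda>G. map (\<lambda>i. Suc i \<in> G) [0..<n]"])
  show "\<forall>xs\<in>{xs. length xs = n \<and> positions xs \<in> \<F>}. map (\<lambda>i. Suc i \<in> positions xs) [0..<n] = xs"
    by (auto intro!: nth_equalityI)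
  show "\<forall>G\<in>\<F>. positions (map (\<lambda>i. Suc i \<in> G) [0..<n]) = G"
    using assms by (auto simp: positions_list)
  show "(\<lambda>G. map (\<lambda>i. Suc i \<in> G) [0..<n]) ` \<F> \<subseteq> {xs. length xs = n \<and> positions xs \<in> \<F>}"
    using assms by (auto simp: positions_list)
qed auto

lemma p_measure_eq_mu:
  assumes "\<F> \<subseteq> Pow {1..n}"
  shows "p_measure n p \<F> = mu p n (\<lambda>xs. positions xs \<in> \<F>)"
proof -
  have "p_measure n p \<F> = (\<Sum>xs | length xs = n \<and> positions xs \<in> \<F>.
      p ^ card (positions xs) * (1 - p) ^ (n - card (positions xs)))"
    unfolding p_measure_def by (rule sum.reindex_bij_betw[OF bij_betw_positions[OF assms], symmetric])
  also have "\<dots> = (\<Sum>xs | length xs = n \<and> positions xs \<in> \<F>. weight p xs)"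
  proof (intro sum.cong refl)
    fix xs assume "xs \<in> {xs. length xs = n \<and> positions xs \<in> \<F>}"
    then have "n - card (positions xs) = count_list xs False"
      using count_list_True_False[of xs] by (simp add: card_positions)
    then show "p ^ card (positions xs) * (1 - p) ^ (n - card (positions xs)) = weight p xs"
      by (simp add: weight_def card_positions)
  qed
  finally show ?thesis by (simp add: mu_eq_sum)
qed

lemma disj3_iff_positions:
  "length xs = n \<Longrightarrow> length ys = n \<Longrightarrow> length zs = n \<Longrightarrow>
    disj3 xs ys zs \<longleftrightarrow> positions xs \<inter> positions ys \<inter> positions zs = {}"
proof (induction n arbitrary: xs ys zs)
  case (Suc n)
  then obtain x xs' y ys' z zs' where e: "xs = x # xs'" "ys = y # ys'" "zs = z # zs'"
    "length xs' = n" "length ys' = n" "length zs' = n" by (auto simp: length_Suc_conv)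
  show ?case using Suc.IH[OF e(4-6)] unfolding e positions_Cons by auto
qed auto

section \<open>Elementary moves that generate \<open>dom\<close>\<close>

definition move_closed :: "nat \<Rightarrow> (bool list \<Rightarrow> bool) \<Rightarrow> bool" where
  "move_closed n P \<longleftrightarrow>
    (\<forall>xs i. length xs = n \<longrightarrow> i < n \<longrightarrow> P xs \<longrightarrow> P (xs[i := True])) \<and>
    (\<forall>xs i j. length xs = n \<longrightarrow> i < j \<longrightarrow> j < n \<longrightarrow> \<not> xs ! i \<longrightarrow> xs ! j \<longrightarrow> P xs \<longrightarrow> P (xs[i := True, j := False]))"

lemma move_closed_Cons:
  assumes "move_closed (Suc n) P"
  shows "move_closed n (\<lambda>xs. P (b # xs))"
  unfolding move_closed_def
proof (intro conjI allI impI)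
  fix xs i assume "length xs = n" "i < n" "P (b # xs)"
  then have "P ((b # xs)[Suc i := True])"
    using assms unfolding move_closed_def by (metis Suc_less_eq length_Cons)
  then show "P (b # xs[i := True])" by simp
next
  fix xs i j assume a: "length xs = n" "i < j" "j < n" "\<not> xs ! i" "xs ! j" "P (b # xs)"
  then have "length (b # xs) = Suc n" "Suc i < Suc j" "Suc j < Suc n" "\<not> (b # xs) ! Suc i" "(b # xs) ! Suc j"
    by auto
  then have "P ((b # xs)[Suc i := True, Suc j := False])"
    using assms a(6) unfolding move_closed_def by blast
  then show "P (b # xs[i := True, j := False])" by simp
qed

text \<open>The first \<open>True\<close> of the first list can be given up: until then the counter
  cannot decrease, so one unit of surplus is still available.\<close>

lemma dom_Suc_move:
  assumes "dom (Suc j) xs ys" "True \<in> set xs"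
  shows "\<exists>i<length xs. xs ! i \<and> dom j (xs[i := False]) ys"
  using assms
proof (induction xs arbitrary: ys j)
  case (Cons x xs)
  from Cons.prems obtain y ys' where y: "ys = y # ys'" by (cases ys) auto
  show ?case
  proof (cases x)
    case True
    with Cons.prems y show ?thesis by (intro exI[of _ 0]) (auto split: if_splits)
  next
    case False
    have "\<exists>k. dom (Suc k) xs ys' \<and> (\<forall>zs. dom k zs ys' \<longrightarrow> dom j (False # zs) ys)"
      using Cons.prems(1) y False by (cases y) auto
    then obtain k where k: "dom (Suc k) xs ys'" "\<And>zs. dom k zs ys' \<Longrightarrow> dom j (False # zs) ys" by blast
    from Cons.IH[OF k(1)] Cons.prems(2) False obtain i where
      "i < length xs" "xs ! i" "dom k (xs[i := False]) ys'" by auto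
    with k(2) False show ?thesis by (intro exI[of _ "Suc i"]) auto
  qed
qed simp

lemma dom_no_True: "True \<notin> set xs \<Longrightarrow> dom j xs ys \<Longrightarrow> dom k xs ys"
proof (induction xs arbitrary: j k ys)
  case Nil
  then show ?case by (cases ys) auto
next
  case (Cons x xs)
  then show ?case by (cases ys) (auto split: if_splits)
qed

text \<open>At the first position where only the second list is \<open>True\<close>, a later
  \<open>True\<close> of the first list is moved forward. If there is none, a point is added
  instead, and the counter no longer matters by \<open>dom_no_True\<close>.\<close>

lemma move_closed_dom:
  assumes "move_closed n P" "length xs = n" "dom 0 xs ys" "P xs"
  shows "P ys"
  using assms
proof (induction n arbitrary: P xs ys)
  case 0
  then show ?case by (cases ys) auto
next
  case (Suc n)
  then obtain x xs' where x: "xs = x # xs'" "length xs' = n" by (auto simp: length_Suc_conv)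
  with Suc.prems obtain y ys' where y: "ys = y # ys'" by (cases ys) auto
  have IH: "P (b # us) \<Longrightarrow> length us = n \<Longrightarrow> dom 0 us ys' \<Longrightarrow> P (b # ys')" for b us
    using Suc.IH[OF move_closed_Cons[OF Suc.prems(1)]] by blast
  consider "x = y" | "\<not> x" "y" "dom (Suc 0) xs' ys'"
    using Suc.prems(3) by (auto simp: x y split: if_splits)
  then show ?case
  proof cases
    case 1
    then show ?thesis using IH Suc.prems x y by auto
  next
    case 2
    show ?thesis
    proof (cases "True \<in> set xs'")
      case True
      from dom_Suc_move[OF 2(3) True] obtain i where
        i: "i < length xs'" "xs' ! i" "dom 0 (xs'[i := False]) ys'" by blast
      have "length xs = Suc n" "0 < Suc i" "Suc i < Suc n" "\<not> xs ! 0" "xs ! Suc i"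
        using i x 2 by auto
      then have "P (xs[0 := True, Suc i := False])"
        using Suc.prems(1,4) unfolding move_closed_def by blast
      then show ?thesis using IH[of True "xs'[i := False]"] i x y 2 by simp
    next
      case False
      have "P (xs[0 := True])"
        using Suc.prems x unfolding move_closed_def by blast
      then show ?thesis using IH[of True xs'] dom_no_True[OF False 2(3)] x y 2 by simp
    qed
  qed
qed

section \<open>Shifting\<close>

text \<open>The classical (i, j)-compression: a set stays in place if its image is already occupied,
  which keeps the map injective.\<close>

definition shift :: "nat \<Rightarrow> nat \<Rightarrow> nat set set \<Rightarrow> nat set \<Rightarrow> nat set" where
  "shift i j \<F> G = (if j \<in> G \<and> i \<notin> G \<and> insert i (G - {j}) \<notin> \<F> then insert i (G - {j}) else G)"

lemma shift_image_iff:
  assumes "i \<noteq> j"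
  shows "H \<in> shift i j \<F> ` \<F> \<longleftrightarrow> H \<in> \<F> \<and> (j \<in> H \<longrightarrow> i \<notin> H \<longrightarrow> insert i (H - {j}) \<in> \<F>) \<or>
    H \<notin> \<F> \<and> i \<in> H \<and> j \<notin> H \<and> insert j (H - {i}) \<in> \<F>" (is "_ \<longleftrightarrow> ?R")
proof
  assume "H \<in> shift i j \<F> ` \<F>"
  then obtain G where G: "G \<in> \<F>" "H = shift i j \<F> G" by blast
  show ?R
  proof (cases "j \<in> G \<and> i \<notin> G \<and> insert i (G - {j}) \<notin> \<F>")
    case True
    then have "insert j (insert i (G - {j}) - {i}) = G" using assms by auto
    with G True assms show ?thesis by (auto simp: shift_def)
  next
    case False
    with G show ?thesis by (auto simp: shift_def)
  qed
next
  assume ?R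
  then show "H \<in> shift i j \<F> ` \<F>"
  proof (elim disjE conjE)
    assume "H \<in> \<F>" "j \<in> H \<longrightarrow> i \<notin> H \<longrightarrow> insert i (H - {j}) \<in> \<F>"
    then have "shift i j \<F> H = H" by (auto simp: shift_def)
    with \<open>H \<in> \<F>\<close> show ?thesis by (metis imageI)
  next
    assume a: "H \<notin> \<F>" "i \<in> H" "j \<notin> H" "insert j (H - {i}) \<in> \<F>"
    then have "insert i (insert j (H - {i}) - {j}) = H" using assms by auto
    then have "shift i j \<F> (insert j (H - {i})) = H" using a assms by (auto simp: shift_def)
    with a(4) show ?thesis by (metis imageI)
  qed
qed

lemma inj_on_shift:
  assumes "i \<noteq> j"
  shows "inj_on (shift i j \<F>) \<F>"
proof (rule inj_onI)
  fix G H assume GH: "G \<in> \<F>" "H \<in> \<F>" and e: "shift i j \<F> G = shift i j \<F> H"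
  have mem: "shift i j \<F> G \<in> \<F> \<longleftrightarrow> shift i j \<F> G = G" if "G \<in> \<F>" for G
    using that by (auto simp: shift_def)
  show "G = H"
  proof (cases "shift i j \<F> G \<in> \<F>")
    case True
    with mem[OF GH(1)] mem[OF GH(2)] e show ?thesis by simp
  next
    case False
    have moved: "j \<in> G" "i \<notin> G" "shift i j \<F> G = insert i (G - {j})"
      if "G \<in> \<F>" "shift i j \<F> G \<notin> \<F>" for G
      using that by (auto simp: shift_def split: if_splits)
    have unshift: "G = insert j (shift i j \<F> G - {i})" if "G \<in> \<F>" "shift i j \<F> G \<notin> \<F>" for G
      using moved[OF that] assms by blast
    show ?thesis using unshift[OF GH(1)] unshift[OF GH(2)] False e by simp
  qed
qed

lemma card_shift:
  assumes "finite G"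
  shows "card (shift i j \<F> G) = card G"
proof -
  have "card (insert i (G - {j})) = card G" if "j \<in> G" "i \<notin> G"
  proof -
    have "card (insert i (G - {j})) = Suc (card (G - {j}))"
      using that assms by (intro card_insert_disjoint) auto
    also have "\<dots> = card G" using that assms by (intro card_Suc_Diff1) auto
    finally show ?thesis .
  qed
  then show ?thesis by (simp add: shift_def)
qed

lemma three_wise_intersecting_obtain:
  fixes g :: "nat \<Rightarrow> nat set"
  assumes "three_wise_intersecting \<F>" "\<And>k. k < 3 \<Longrightarrow> g k \<in> \<F>"
  obtains x where "\<And>k. k < 3 \<Longrightarrow> x \<in> g k"
proof -
  have "g 0 \<inter> g 1 \<inter> g 2 \<noteq> {}" using assms by (simp add: three_wise_intersecting_def)
  then obtain x where x: "x \<in> g 0" "x \<in> g 1" "x \<in> g 2" by blast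
  have "x \<in> g k" if "k < 3" for k
  proof -
    have "k = 0 \<or> k = 1 \<or> k = 2" using that by linarith
    with x show ?thesis by blast
  qed
  with that show ?thesis by blast
qed

text \<open>Suppose three shifted sets have no common point. Replacing the moved ones by their
  preimages gives members whose only common point is j. One of the three sets avoids i; it was not
  moved although it contains j, so its image under the exchange is also a member. Using that image
  instead yields a common point other than i and j, which lies in all three original sets.\<close>

lemma three_wise_intersecting_shift:
  assumes ij: "i \<noteq> j" and F: "three_wise_intersecting \<F>"
  shows "three_wise_intersecting (shift i j \<F> ` \<F>)"
  unfolding three_wise_intersecting_def
proof (intro ballI notI)
  fix A B C
  assume ABC: "A \<in> shift i j \<F> ` \<F>" "B \<in> shift i j \<F> ` \<F>" "C \<in> shift i j \<F> ` \<F>"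
    and disjoint: "A \<inter> B \<inter> C = {}"
  define g where "g k = (if k = 0 then A else if k = 1 then B else C)" for k :: nat
  have g: "g k \<in> shift i j \<F> ` \<F>" for k using ABC by (simp add: g_def)
  have empty: False if x: "\<And>k. k < 3 \<Longrightarrow> x \<in> g k" for x
    using x[of 0] x[of 1] x[of 2] disjoint by (auto simp: g_def)
  have old: "insert i (g k - {j}) \<in> \<F>" if "g k \<in> \<F>" "j \<in> g k" "i \<notin> g k" for k
    using g[of k] that unfolding shift_image_iff[OF ij] by blast
  have new: "i \<in> g k" "j \<notin> g k" "insert j (g k - {i}) \<in> \<F>" if "g k \<notin> \<F>" for k
    using g[of k] that unfolding shift_image_iff[OF ij] by blast+
  define h where "h k = (if g k \<in> \<F> then g k else insert j (g k - {i}))" for k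
  have h: "h k \<in> \<F>" for k using new[of k] by (simp add: h_def)
  \<comment> \<open>At least one set was really moved; its preimage lacks i, which later excludes y
    = i.\<close>
  obtain m where m: "m < 3" "g m \<notin> \<F>"
    using three_wise_intersecting_obtain[OF F, of g] empty by blast
  obtain x where x: "\<And>k. k < 3 \<Longrightarrow> x \<in> h k"
    using three_wise_intersecting_obtain[OF F, of h] h by blast
  have "x = j"
  proof (rule ccontr)
    assume "x \<noteq> j"
    then have "x \<in> g k" if "k < 3" for k using x[OF that] by (auto simp: h_def split: if_splits)
    then show False by (rule empty)
  qed
  obtain k where k: "k < 3" "i \<notin> g k" using empty by blast
  with new have kF: "g k \<in> \<F>" by blast
  with x[OF k(1)] \<open>x = j\<close> have "j \<in> g k" by (simp add: h_def)
  with old k kF have k': "insert i (g k - {j}) \<in> \<F>" by blast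
  define h' where "h' = h(k := insert i (g k - {j}))"
  have "h' l \<in> \<F>" for l using h[of l] k' by (simp add: h'_def)
  then obtain y where y: "\<And>l. l < 3 \<Longrightarrow> y \<in> h' l"
    using three_wise_intersecting_obtain[OF F, of h'] by blast
  have "y \<noteq> j" using y[OF k(1)] ij by (auto simp: h'_def)
  have "m \<noteq> k" using m kF by auto
  with y[OF m(1)] m \<open>y \<noteq> j\<close> have "y \<noteq> i" by (auto simp: h'_def h_def)
  have "y \<in> g l" if "l < 3" for l
    using y[OF that] \<open>y \<noteq> i\<close> \<open>y \<noteq> j\<close> by (auto simp: h'_def h_def split: if_splits)
  then show False by (rule empty)
qed

text \<open>Shifting may make a non-trivial family trivial, so non-triviality is recorded by the
  members [n] - {i}, which survive.\<close>

definition up_family :: "nat \<Rightarrow> nat set set \<Rightarrow> bool" where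
  "up_family n \<F> \<longleftrightarrow> \<F> \<subseteq> Pow {1..n} \<and> three_wise_intersecting \<F> \<and>
    (\<forall>i\<in>{1..n}. {1..n} - {i} \<in> \<F>) \<and> (\<forall>A\<in>\<F>. \<forall>B. A \<subseteq> B \<longrightarrow> B \<subseteq> {1..n} \<longrightarrow> B \<in> \<F>)"

lemma up_familyD:
  assumes "up_family n \<F>"
  shows "\<F> \<subseteq> Pow {1..n}" "three_wise_intersecting \<F>" "k \<in> {1..n} \<Longrightarrow> {1..n} - {k} \<in> \<F>"
    "A \<in> \<F> \<Longrightarrow> A \<subseteq> B \<Longrightarrow> B \<subseteq> {1..n} \<Longrightarrow> B \<in> \<F>"
proof -
  note c = assms[unfolded up_family_def]
  show "\<F> \<subseteq> Pow {1..n}" by (rule c[THEN conjunct1])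
  show "three_wise_intersecting \<F>" by (rule c[THEN conjunct2, THEN conjunct1])
  show "{1..n} - {k} \<in> \<F>" if "k \<in> {1..n}"
    by (rule c[THEN conjunct2, THEN conjunct2, THEN conjunct1, rule_format, OF that])
  show "B \<in> \<F>" if "A \<in> \<F>" "A \<subseteq> B" "B \<subseteq> {1..n}"
    by (rule c[THEN conjunct2, THEN conjunct2, THEN conjunct2, rule_format, OF that])
qed

lemma up_familyI:
  assumes "\<And>G. G \<in> \<F> \<Longrightarrow> G \<subseteq> {1..n}" "three_wise_intersecting \<F>"
    "\<And>k. k \<in> {1..n} \<Longrightarrow> {1..n} - {k} \<in> \<F>"
    "\<And>A B. A \<in> \<F> \<Longrightarrow> A \<subseteq> B \<Longrightarrow> B \<subseteq> {1..n} \<Longrightarrow> B \<in> \<F>"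
  shows "up_family n \<F>"
  unfolding up_family_def
proof (intro conjI ballI allI impI)
  show "\<F> \<subseteq> Pow {1..n}" using assms(1) by blast
qed (rule assms; assumption)+

lemma up_family_shift:
  assumes ij: "i \<noteq> j" "i \<in> {1..n}" "j \<in> {1..n}" and F: "up_family n \<F>"
  shows "up_family n (shift i j \<F> ` \<F>)"
proof (rule up_familyI)
  note sub = up_familyD(1)[OF F] and drop = up_familyD(3)[OF F] and up = up_familyD(4)[OF F]
  show "three_wise_intersecting (shift i j \<F> ` \<F>)"
    by (rule three_wise_intersecting_shift[OF ij(1) up_familyD(2)[OF F]])
  show "G \<subseteq> {1..n}" if "G \<in> shift i j \<F> ` \<F>" for G
  proof -
    from that obtain H where "H \<in> \<F>" "G = shift i j \<F> H" by blast
    moreover from this sub have "H \<subseteq> {1..n}" by blast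
    ultimately show ?thesis using ij(2) unfolding shift_def by auto
  qed
  show "{1..n} - {k} \<in> shift i j \<F> ` \<F>" if "k \<in> {1..n}" for k
  proof -
    \<comment> \<open>Only [n] - {i} could be moved, but its image [n] - {j} is already a
      member.\<close>
    have "insert i ({1..n} - {k} - {j}) \<in> \<F>" if "i \<notin> {1..n} - {k}"
    proof -
      have "k = i" using that ij by auto
      then have "insert i ({1..n} - {k} - {j}) = {1..n} - {j}" using ij by auto
      then show ?thesis using drop[OF ij(3)] by simp
    qed
    with drop[OF that] show ?thesis unfolding shift_image_iff[OF ij(1)] by blast
  qed
  show "B \<in> shift i j \<F> ` \<F>"
    if A: "A \<in> shift i j \<F> ` \<F>" and AB: "A \<subseteq> B" and B: "B \<subseteq> {1..n}" for A B
    using A unfolding shift_image_iff[OF ij(1)]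
  proof (elim disjE conjE)
    assume a: "A \<in> \<F>" "j \<in> A \<longrightarrow> i \<notin> A \<longrightarrow> insert i (A - {j}) \<in> \<F>"
    have "insert i (B - {j}) \<in> \<F>" if "i \<notin> B"
    proof (cases "j \<in> A")
      case True
      with a that AB have "insert i (A - {j}) \<in> \<F>" by blast
      then show ?thesis by (rule up) (use AB B ij in auto)
    next
      case False
      show ?thesis by (rule up[OF a(1)]) (use False AB B ij in auto)
    qed
    moreover have "B \<in> \<F>" by (rule up[OF a(1) AB B])
    ultimately show "B \<in> \<F> \<and> (j \<in> B \<longrightarrow> i \<notin> B \<longrightarrow> insert i (B - {j}) \<in> \<F>) \<or>
      B \<notin> \<F> \<and> i \<in> B \<and> j \<notin> B \<and> insert j (B - {i}) \<in> \<F>" by blast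
  next
    assume a: "A \<notin> \<F>" "i \<in> A" "j \<notin> A" "insert j (A - {i}) \<in> \<F>"
    have "j \<notin> B" if "B \<notin> \<F>" using up[OF a(4), of B] that AB B by blast
    moreover have "insert j (B - {i}) \<in> \<F>" using AB B ij by (intro up[OF a(4)]) auto
    ultimately show "B \<in> \<F> \<and> (j \<in> B \<longrightarrow> i \<notin> B \<longrightarrow> insert i (B - {j}) \<in> \<F>) \<or>
      B \<notin> \<F> \<and> i \<in> B \<and> j \<notin> B \<and> insert j (B - {i}) \<in> \<F>" using a AB by blast
  qed
qed

lemma up_family_finite:
  assumes "up_family n \<F>"
  shows "finite \<F>" "G \<in> \<F> \<Longrightarrow> finite G"
proof -
  have sub: "\<F> \<subseteq> Pow {1..n}" by (rule up_familyD(1)[OF assms])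
  then show "finite \<F>" by (rule finite_subset) simp
  show "finite G" if "G \<in> \<F>"
    by (rule finite_subset[of _ "{1..n}"]) (use sub that in auto)
qed

lemma p_measure_shift:
  assumes "i \<noteq> j" "up_family n \<F>"
  shows "p_measure n p (shift i j \<F> ` \<F>) = p_measure n p \<F>"
  unfolding p_measure_def using up_family_finite[OF assms(2)] card_shift
  by (subst sum.reindex[OF inj_on_shift[OF assms(1)]]) (auto intro!: sum.cong)

text \<open>Take a family that minimises the sum of all elements of all its members; any shift with
  i < j that changes it would lower this sum.\<close>

lemma exists_shifted_family:
  assumes "up_family n \<F>"
  shows "\<exists>\<G>. up_family n \<G> \<and> p_measure n p \<G> = p_measure n p \<F> \<and>
    (\<forall>G\<in>\<G>. \<forall>i\<in>{1..n}. \<forall>j\<in>{1..n}. i < j \<longrightarrow> j \<in> G \<longrightarrow> i \<notin> G \<longrightarrow> insert i (G - {j}) \<in> \<G>)"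
proof -
  let ?Q = "\<lambda>\<G>. up_family n \<G> \<and> p_measure n p \<G> = p_measure n p \<F>"
  let ?w = "\<lambda>\<G>. \<Sum>G\<in>\<G>. \<Sum>G"
  obtain \<G> where G: "?Q \<G>" and min: "\<And>\<H>. ?Q \<H> \<Longrightarrow> ?w \<G> \<le> ?w \<H>"
    using ex_has_least_nat[of ?Q \<F> ?w] assms by blast
  have fin: "finite \<G>" "\<And>G. G \<in> \<G> \<Longrightarrow> finite G" using up_family_finite G by metis+
  have "insert i (G - {j}) \<in> \<G>"
    if *: "G \<in> \<G>" "i \<in> {1..n}" "j \<in> {1..n}" "i < j" "j \<in> G" "i \<notin> G" for G i j
  proof (rule ccontr)
    assume no: "insert i (G - {j}) \<notin> \<G>"
    have sum_less: "\<Sum>(insert i (H - {j})) < \<Sum>H" if "finite H" "j \<in> H" "i \<notin> H" for H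
      using that *(4) by (simp add: sum.remove[of H j])
    have "?w (shift i j \<G> ` \<G>) = (\<Sum>H\<in>\<G>. \<Sum>(shift i j \<G> H))"
      using inj_on_shift *(4) by (subst sum.reindex) auto
    also have "\<dots> < ?w \<G>"
    proof (rule sum_strict_mono_ex1[OF fin(1)])
      show "\<forall>H\<in>\<G>. \<Sum>(shift i j \<G> H) \<le> \<Sum>H"
        using sum_less fin(2) by (auto simp: shift_def intro: less_imp_le)
      show "\<exists>H\<in>\<G>. \<Sum>(shift i j \<G> H) < \<Sum>H"
        using sum_less fin(2) no * by (intro bexI[of _ G]) (auto simp: shift_def)
    qed
    finally have "?w (shift i j \<G> ` \<G>) < ?w \<G>" .
    moreover have "?Q (shift i j \<G> ` \<G>)"
      using up_family_shift[of i j n \<G>] p_measure_shift[of i j n \<G> p] G * by auto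
    ultimately show False using min by (meson not_less)
  qed
  then show ?thesis using G by blast
qed

lemma exists_up_family:
  assumes p: "0 \<le> p" "p \<le> 1" and F: "\<F> \<subseteq> Pow {1..n}" "three_wise_intersecting \<F>" "nontrivial_family \<F>"
  shows "\<exists>\<G>. up_family n \<G> \<and> p_measure n p \<F> \<le> p_measure n p \<G>"
proof (intro exI conjI)
  let ?G = "{B. B \<subseteq> {1..n} \<and> (\<exists>A\<in>\<F>. A \<subseteq> B)}"
  have "three_wise_intersecting ?G"
    unfolding three_wise_intersecting_def
  proof (intro ballI)
    fix X Y Z assume "X \<in> ?G" "Y \<in> ?G" "Z \<in> ?G"
    then obtain A B C where "A \<in> \<F>" "B \<in> \<F>" "C \<in> \<F>" "A \<subseteq> X" "B \<subseteq> Y" "C \<subseteq> Z" by blast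
    moreover from this F(2) have "A \<inter> B \<inter> C \<noteq> {}" by (simp add: three_wise_intersecting_def)
    ultimately show "X \<inter> Y \<inter> Z \<noteq> {}" by blast
  qed
  moreover have "{1..n} - {i} \<in> ?G" if "i \<in> {1..n}" for i
  proof -
    \<comment> \<open>Hence some member avoids i, and [n] - {i} lies above it.\<close>
    have "i \<notin> \<Inter>\<F>" using F(3) by (simp add: nontrivial_family_def)
    then show ?thesis using F(1) by blast
  qed
  moreover have "B \<in> ?G" if "A \<in> ?G" "A \<subseteq> B" "B \<subseteq> {1..n}" for A B using that by blast
  moreover have "G \<subseteq> {1..n}" if "G \<in> ?G" for G using that by blast
  ultimately show "up_family n ?G" by (intro up_familyI)
  show "p_measure n p \<F> \<le> p_measure n p ?G"
    unfolding p_measure_def using F(1) p by (intro sum_mono2) auto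
qed

lemma positions_update_True:
  "i < length xs \<Longrightarrow> positions (xs[i := True]) = insert (Suc i) (positions xs)"
  by (auto simp: positions_def nth_list_update split: if_splits)

lemma positions_update_False:
  "positions (xs[i := False]) = positions xs - {Suc i}"
  by (cases "i < length xs") (auto simp: positions_def nth_list_update split: if_splits)

lemma positions_replicate_True: "positions (replicate n True) = {1..n}"
proof -
  have "k \<in> positions (replicate n True) \<longleftrightarrow> k \<in> {1..n}" for k by (cases k) auto
  then show ?thesis by blast
qed

lemma positions_mono:
  assumes "list_all2 (\<longrightarrow>) xs ys"
  shows "positions xs \<subseteq> positions ys"
  using assms by (auto simp: positions_def list_all2_conv_all_nth)

lemma up_family_upclosed:
  assumes "up_family n \<F>"
  shows "upclosed n (\<lambda>xs. positions xs \<in> \<F>)"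
  unfolding upclosed_def
proof (intro allI impI)
  fix xs ys assume "length xs = n" "list_all2 (\<longrightarrow>) xs ys" "positions xs \<in> \<F>"
  moreover from this have "positions ys \<subseteq> {1..n}"
    using positions_subset[of ys] list_all2_lengthD by metis
  ultimately show "positions ys \<in> \<F>" using up_familyD(4)[OF assms] positions_mono by blast
qed

lemma up_family_not_disj3:
  assumes "up_family n \<F>" "length xs = n" "length ys = n" "length zs = n"
    "positions xs \<in> \<F>" "positions ys \<in> \<F>" "positions zs \<in> \<F>"
  shows "\<not> disj3 xs ys zs"
  using disj3_iff_positions[OF assms(2-4)] up_familyD(2)[OF assms(1)] assms(5-7)
  by (simp add: three_wise_intersecting_def)

lemma stable_family_positions:
  assumes n: "0 < n" and F: "up_family n \<F>"
    and sh: "\<forall>G\<in>\<F>. \<forall>i\<in>{1..n}. \<forall>j\<in>{1..n}. i < j \<longrightarrow> j \<in> G \<longrightarrow> i \<notin> G \<longrightarrow> insert i (G - {j}) \<in> \<F>"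
  shows "stable_family n (\<lambda>xs. positions xs \<in> \<F>)"
proof
  have mc: "move_closed n (\<lambda>xs. positions xs \<in> \<F>)"
    unfolding move_closed_def
  proof (intro conjI allI impI)
    fix xs i assume a: "length xs = n" "i < n" "positions xs \<in> \<F>"
    then have "positions xs \<subseteq> insert (Suc i) (positions xs)" "insert (Suc i) (positions xs) \<subseteq> {1..n}"
      using positions_subset[of xs] by auto
    then have "insert (Suc i) (positions xs) \<in> \<F>" by (rule up_familyD(4)[OF F a(3)])
    then show "positions (xs[i := True]) \<in> \<F>" using a by (simp add: positions_update_True)
  next
    fix xs i j assume a: "length xs = n" "i < j" "j < n" "\<not> xs ! i" "xs ! j" "positions xs \<in> \<F>"
    then have "insert (Suc i) (positions xs - {Suc j}) \<in> \<F>"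
      using sh[rule_format, of "positions xs" "Suc i" "Suc j"] by auto
    moreover have "positions (xs[i := True, j := False]) = insert (Suc i) (positions xs - {Suc j})"
      using a by (auto simp: positions_update_True positions_update_False)
    ultimately show "positions (xs[i := True, j := False]) \<in> \<F>" by simp
  qed
  show "positions ys \<in> \<F>" if "length xs = n" "dom 0 xs ys" "positions xs \<in> \<F>" for xs ys
    using move_closed_dom[OF mc] that by blast
  show "\<not> disj3 xs ys zs" if "length xs = n" "length ys = n" "length zs = n"
    "positions xs \<in> \<F>" "positions ys \<in> \<F>" "positions zs \<in> \<F>" for xs ys zs
    using up_family_not_disj3[OF F] that by blast
  have "positions (False # replicate (n - 1) True) = {1..n} - {1}"
  proof -
    have "positions ((replicate n True)[0 := False]) = {1..n} - {1}"
      by (simp add: positions_update_False positions_replicate_True)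
    then show ?thesis using n by (cases n) auto
  qed
  then show "positions (False # replicate (n - 1) True) \<in> \<F>" using up_familyD(3)[OF F, of 1] n by simp
qed

section \<open>Lower bounds and the limit\<close>

abbreviation families :: "nat \<Rightarrow> nat set set set" where
  "families n \<equiv> {\<G>. \<G> \<subseteq> Pow {1..n} \<and> three_wise_intersecting \<G> \<and> nontrivial_family \<G>}"

abbreviation trues :: "bool list \<Rightarrow> nat" where "trues xs \<equiv> count_list xs True"

lemma disj3_trues:
  "disj3 xs ys zs \<Longrightarrow> length xs = n \<Longrightarrow> length ys = n \<Longrightarrow> length zs = n \<Longrightarrow>
    trues xs + trues ys + trues zs \<le> 2 * n"
proof (induction xs ys zs arbitrary: n rule: disj3.induct)
  case (1 x xs y ys z zs)
  then have "trues xs + trues ys + trues zs \<le> 2 * (n - 1)" "0 < n" by auto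
  then show ?case using 1(2) by (auto split: if_splits)
qed auto

lemma trues_replicate [simp]: "trues (replicate n True) = n"
  by (induction n) auto

lemma trues_drop_one: "i < n \<Longrightarrow> trues ((replicate n True)[i := False]) = n - 1"
proof (induction n arbitrary: i)
  case (Suc n)
  then show ?case by (cases i) auto
qed simp

lemma exists_family:
  assumes p: "0 \<le> p" "p \<le> 1" and n: "0 < n"
    and int: "\<And>xs ys zs. length xs = n \<Longrightarrow> length ys = n \<Longrightarrow> length zs = n \<Longrightarrow>
      P xs \<Longrightarrow> P ys \<Longrightarrow> P zs \<Longrightarrow> \<not> disj3 xs ys zs"
    and drop: "\<And>i. i < n \<Longrightarrow> P ((replicate n True)[i := False])"
  shows "\<exists>\<F>\<in>families n. mu p n P \<le> p_measure n p \<F>"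
proof
  let ?F = "positions ` {xs. length xs = n \<and> P xs}"
  have sub: "?F \<subseteq> Pow {1..n}" using positions_subset by fastforce
  have "three_wise_intersecting ?F"
    unfolding three_wise_intersecting_def
  proof (intro ballI)
    fix A B C assume "A \<in> ?F" "B \<in> ?F" "C \<in> ?F"
    then obtain xs ys zs where "A = positions xs" "B = positions ys" "C = positions zs"
      "length xs = n" "length ys = n" "length zs = n" "P xs" "P ys" "P zs" by blast
    then show "A \<inter> B \<inter> C \<noteq> {}" using int[of xs ys zs] disj3_iff_positions[of xs n ys zs] by simp
  qed
  moreover have "nontrivial_family ?F"
  proof -
    have D: "{1..n} - {Suc i} \<in> ?F" if "i < n" for i
    proof -
      have "positions ((replicate n True)[i := False]) \<in> ?F" using drop[OF that] by (intro imageI) simp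
      then show ?thesis by (simp only: positions_update_False positions_replicate_True)
    qed
    have "k \<notin> \<Inter>?F" for k
    proof
      assume k: "k \<in> \<Inter>?F"
      \<comment> \<open>Membership in [n] - {1} ensures 1 <= k <= n, so k - 1 is a valid list index
        and [n] - {k} gives the contradiction.\<close>
      have "k \<in> {1..n} - {Suc 0}" using InterD[OF k D[OF n]] .
      then have "k - 1 < n" "Suc (k - 1) = k" by auto
      with InterD[OF k D[of "k - 1"]] show False by simp
    qed
    then show ?thesis unfolding nontrivial_family_def by blast
  qed
  ultimately show "?F \<in> families n" using sub by blast
  show "mu p n P \<le> p_measure n p ?F"
    unfolding p_measure_eq_mu[OF sub] by (intro mu_mono p) auto
qed

lemma finite_families: "finite (families n)"
  by (rule finite_subset[of _ "Pow (Pow {1..n})"]) auto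

lemma mu_le_M3_fin:
  assumes "0 \<le> p" "p \<le> 1" "0 < n"
    and "\<And>xs ys zs. length xs = n \<Longrightarrow> length ys = n \<Longrightarrow> length zs = n \<Longrightarrow>
      P xs \<Longrightarrow> P ys \<Longrightarrow> P zs \<Longrightarrow> \<not> disj3 xs ys zs"
    and "\<And>i. i < n \<Longrightarrow> P ((replicate n True)[i := False])"
  shows "mu p n P \<le> M3_fin n p"
proof -
  from exists_family[of p n P, OF assms] obtain \<F> where "\<F> \<in> families n" "mu p n P \<le> p_measure n p \<F>" ..
  then show ?thesis
    unfolding M3_fin_def using finite_families by (meson Max_ge finite_imageI imageI order_trans)
qed

fun three_of_four :: "bool list \<Rightarrow> bool" where
  "three_of_four (a # b # c # d # xs) \<longleftrightarrow> 3 \<le> trues [a, b, c, d]"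
| "three_of_four _ \<longleftrightarrow> False"

text \<open>Three sets with three of the four points have 9 incidences there; without a common point
  they could have at most 8.\<close>

lemma three_of_four_not_disj3:
  assumes "length xs = Suc (Suc (Suc (Suc N)))" "length ys = Suc (Suc (Suc (Suc N)))"
    "length zs = Suc (Suc (Suc (Suc N)))" "three_of_four xs" "three_of_four ys" "three_of_four zs"
  shows "\<not> disj3 xs ys zs"
proof
  assume d: "disj3 xs ys zs"
  obtain a b c e xs' where x: "xs = a # b # c # e # xs'" using assms(1) by (auto simp: length_Suc_conv)
  obtain a' b' c' e' ys' where y: "ys = a' # b' # c' # e' # ys'" using assms(2) by (auto simp: length_Suc_conv)
  obtain a'' b'' c'' e'' zs' where z: "zs = a'' # b'' # c'' # e'' # zs'"
    using assms(3) by (auto simp: length_Suc_conv)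
  have "disj3 [a, b, c, e] [a', b', c', e'] [a'', b'', c'', e'']" using d by (simp add: x y z)
  from disj3_trues[OF this, of 4] assms(4-6) show False
    unfolding x y z three_of_four.simps by simp
qed

lemma three_of_four_drop:
  "i < Suc (Suc (Suc (Suc N))) \<Longrightarrow> three_of_four ((replicate (Suc (Suc (Suc (Suc N)))) True)[i := False])"
  by (cases i rule: nat.exhaust; cases "i - 1"; cases "i - 2"; cases "i - 3") auto

lemma ge4_obtain: "4 \<le> n \<Longrightarrow> \<exists>N. n = Suc (Suc (Suc (Suc N)))"
  using le_Suc_ex by (fastforce simp: eval_nat_numeral)

lemma M3_fin_le:
  assumes n: "4 \<le> n" and p: "0 \<le> p" "p \<le> 1" and le: "\<And>\<F>. \<F> \<in> families n \<Longrightarrow> p_measure n p \<F> \<le> c"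
  shows "M3_fin n p \<le> c"
proof -
  obtain N where N: "n = Suc (Suc (Suc (Suc N)))" using ge4_obtain[OF n] by blast
  \<comment> \<open>A witness is needed so that \<open>Max\<close> ranges over a nonempty
    set.\<close>
  have "\<exists>\<F>\<in>families n. mu p n three_of_four \<le> p_measure n p \<F>"
    using n unfolding N
    by (intro exists_family p three_of_four_not_disj3[of _ N] three_of_four_drop) simp_all
  then have ne: "p_measure n p ` families n \<noteq> {}" by blast
  show ?thesis unfolding M3_fin_def
  proof (rule Max.boundedI[OF finite_imageI[OF finite_families] ne])
    fix a assume "a \<in> p_measure n p ` families n"
    then obtain \<F> where "a = p_measure n p \<F>" "\<F> \<in> families n" by (rule imageE)
    with le show "a \<le> c" by (simp only:)
  qed
qed

lemma M3_fin_le_stable: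
  assumes n: "4 \<le> n" and p: "0 \<le> p" "p \<le> 1" and le: "\<And>P. stable_family n P \<Longrightarrow> mu p n P \<le> c"
  shows "M3_fin n p \<le> c"
proof (rule M3_fin_le[OF n p])
  fix \<F> assume "\<F> \<in> families n"
  then obtain \<G> where G: "up_family n \<G>" "p_measure n p \<F> \<le> p_measure n p \<G>"
    using exists_up_family[OF p, of \<F> n] by auto
  obtain \<H> where H: "up_family n \<H>" "p_measure n p \<H> = p_measure n p \<G>"
    "\<forall>G\<in>\<H>. \<forall>i\<in>{1..n}. \<forall>j\<in>{1..n}. i < j \<longrightarrow> j \<in> G \<longrightarrow> i \<notin> G \<longrightarrow> insert i (G - {j}) \<in> \<H>"
    using exists_shifted_family[OF G(1), of p] by (elim exE conjE)
  have "p_measure n p \<H> \<le> c"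
    unfolding p_measure_eq_mu[OF up_familyD(1)[OF H(1)]]
    using n by (intro le stable_family_positions[OF _ H(1) H(3)]) simp
  with G H show "p_measure n p \<F> \<le> c" by simp
qed

lemma M3_fin_le_prob:
  assumes n: "4 \<le> n" and p: "0 < p" "p \<le> 2/3"
  shows "M3_fin n p \<le> p"
proof (rule M3_fin_le[OF n])
  fix \<F> assume "\<F> \<in> families n"
  then obtain \<G> where G: "up_family n \<G>" "p_measure n p \<F> \<le> p_measure n p \<G>"
    using exists_up_family[of p \<F> n] p by auto
  have "p_measure n p \<G> \<le> p"
    unfolding p_measure_eq_mu[OF up_familyD(1)[OF G(1)]]
    by (rule mu_le_prob[OF p up_family_upclosed[OF G(1)]]) (rule up_family_not_disj3[OF G(1)])
  with G show "p_measure n p \<F> \<le> p" by simp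
qed (use p in auto)

lemma M3_fin_le_1:
  assumes "4 \<le> n" "0 \<le> p" "p \<le> 1"
  shows "M3_fin n p \<le> 1"
proof (rule M3_fin_le[OF assms])
  fix \<F> assume "\<F> \<in> families n"
  then have "\<F> \<subseteq> Pow {1..n}" by simp
  then show "p_measure n p \<F> \<le> 1" unfolding p_measure_eq_mu[OF \<open>\<F> \<subseteq> Pow {1..n}\<close>]
    by (intro mu_le_1 assms)
qed

text \<open>The offset a absorbs the first coordinate in the induction; for a = -np the formula is
  the variance.\<close>

lemma expect_square:
  "expect p n (\<lambda>xs. (real (trues xs) + a)\<^sup>2) = (real n * p + a)\<^sup>2 + real n * p * (1 - p)"
proof (induction n arbitrary: a)
  case (Suc n)
  have "expect p (Suc n) (\<lambda>xs. (real (trues xs) + a)\<^sup>2)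
    = p * expect p n (\<lambda>xs. (real (trues xs) + (1 + a))\<^sup>2) + (1 - p) * expect p n (\<lambda>xs. (real (trues xs) + a)\<^sup>2)"
    by (simp add: add_ac)
  also have "\<dots> = (real (Suc n) * p + a)\<^sup>2 + real (Suc n) * p * (1 - p)"
    unfolding Suc by (simp add: algebra_simps power2_eq_square)
  finally show ?case .
qed simp

text \<open>Chebyshev's inequality for the number of points.\<close>

lemma mu_trues_ge:
  assumes p: "0 \<le> p" "p \<le> 1" and t: "t < p" and n: "0 < n"
  shows "1 - p * (1 - p) / (p - t)\<^sup>2 * (1 / real n) \<le> mu p n (\<lambda>xs. t * real n < real (trues xs))"
proof -
  let ?c = "((p - t) * real n)\<^sup>2"
  have c: "0 < ?c" using t n by simp
  have "?c * (1 - of_bool (t * real n < real (trues xs))) \<le> (real (trues xs) + - (real n * p))\<^sup>2" for xs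
  proof (cases "t * real n < real (trues xs)")
    case False
    then have "(p - t) * real n \<le> real n * p - real (trues xs)" by (simp add: algebra_simps)
    moreover have "0 \<le> (p - t) * real n" using t by simp
    ultimately have "?c \<le> (real n * p - real (trues xs))\<^sup>2" by (intro power_mono)
    with False show ?thesis by (simp add: power2_commute)
  qed simp
  then have "expect p n (\<lambda>xs. ?c * (1 - of_bool (t * real n < real (trues xs))))
    \<le> expect p n (\<lambda>xs. (real (trues xs) + - (real n * p))\<^sup>2)" by (intro expect_mono p)
  also have "\<dots> = real n * p * (1 - p)" by (subst expect_square) simp
  finally have "?c * expect p n (\<lambda>xs. 1 - of_bool (t * real n < real (trues xs))) \<le> real n * p * (1 - p)"
    by (simp add: expect_cmult)
  then have "expect p n (\<lambda>xs. 1 - of_bool (t * real n < real (trues xs))) \<le> real n * p * (1 - p) / ?c"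
    using c by (simp add: pos_le_divide_eq mult.commute)
  also have "\<dots> = p * (1 - p) / (p - t)\<^sup>2 * (1 / real n)"
  proof -
    have "real n * p * (1 - p) / (d * real n)\<^sup>2 = p * (1 - p) / d\<^sup>2 * (1 / real n)"
      if "d \<noteq> 0" for d :: real
      using n that by (simp add: field_simps power2_eq_square)
    then show ?thesis using t by simp
  qed
  finally show ?thesis
    using expect_add[of p n "\<lambda>xs. 1 - of_bool (t * real n < real (trues xs))"
        "\<lambda>xs. of_bool (t * real n < real (trues xs))"] by simp
qed

lemma mu_trues_tendsto_1:
  assumes p: "0 \<le> p" "p \<le> 1" and t: "t < p"
  shows "(\<lambda>n. mu p n (\<lambda>xs. t * real n < real (trues xs))) \<longlonglongrightarrow> 1"
proof (rule tendsto_sandwich)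
  have "(\<lambda>n. 1 - p * (1 - p) / (p - t)\<^sup>2 * (1 / real n)) \<longlonglongrightarrow> 1 - p * (1 - p) / (p - t)\<^sup>2 * 0"
    by (intro tendsto_intros lim_1_over_n)
  then show "(\<lambda>n. 1 - p * (1 - p) / (p - t)\<^sup>2 * (1 / real n)) \<longlonglongrightarrow> 1" by simp
  show "\<forall>\<^sub>F n in sequentially. 1 - p * (1 - p) / (p - t)\<^sup>2 * (1 / real n)
      \<le> mu p n (\<lambda>xs. t * real n < real (trues xs))"
    using eventually_gt_at_top[of 0] by eventually_elim (rule mu_trues_ge[OF p t])
qed (auto simp: mu_le_1 p)

lemma M3_fin_tendsto_1:
  assumes p: "2/3 < p" "p < 1"
  shows "(\<lambda>n. M3_fin n p) \<longlonglongrightarrow> 1"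
proof (rule tendsto_sandwich)
  show "(\<lambda>n. mu p n (\<lambda>xs. 2/3 * real n < real (trues xs))) \<longlonglongrightarrow> 1"
    using p by (intro mu_trues_tendsto_1) auto
  show "\<forall>\<^sub>F n in sequentially. mu p n (\<lambda>xs. 2/3 * real n < real (trues xs)) \<le> M3_fin n p"
    using eventually_ge_at_top[of 4]
  proof eventually_elim
    case (elim n)
    show ?case
    proof (rule mu_le_M3_fin)
      fix xs ys zs assume "length xs = n" "length ys = n" "length zs = n" and
        r: "2/3 * real n < real (trues xs)" "2/3 * real n < real (trues ys)" "2/3 * real n < real (trues zs)"
      then have "disj3 xs ys zs \<Longrightarrow> real (trues xs + trues ys + trues zs) \<le> real (2 * n)"
        using disj3_trues of_nat_le_iff by blast
      with r show "\<not> disj3 xs ys zs" by auto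
    next
      \<comment> \<open>This needs 2n/3 < n - 1, that is n >= 4.\<close>
      fix i assume "i < n"
      then show "2/3 * real n < real (trues ((replicate n True)[i := False]))"
        unfolding trues_drop_one[OF \<open>i < n\<close>] using elim by (simp add: of_nat_diff)
    qed (use p elim in auto)
  qed
  show "\<forall>\<^sub>F n in sequentially. M3_fin n p \<le> 1"
    using eventually_ge_at_top[of 4] by eventually_elim (use M3_fin_le_1 p in auto)
qed auto

text \<open>Against [n] - {1}, two sets with more than half of the other points still share a point
  beyond 1, while the sets through 1 carry almost all of the measure p when p > 1/2.\<close>

fun star_like :: "bool list \<Rightarrow> bool" where
  "star_like (a # xs) \<longleftrightarrow> (if a then length xs < 2 * trues xs else trues xs = length xs)"
| "star_like [] \<longleftrightarrow> False"

lemma star_like_not_disj3: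
  assumes "length xs = Suc N" "length ys = Suc N" "length zs = Suc N" "0 < N"
    "star_like xs" "star_like ys" "star_like zs"
  shows "\<not> disj3 xs ys zs"
proof
  assume d: "disj3 xs ys zs"
  obtain a xs' b ys' c zs' where e: "xs = a # xs'" "ys = b # ys'" "zs = c # zs'"
    "length xs' = N" "length ys' = N" "length zs' = N"
    using assms(1-3) by (auto simp: length_Suc_conv)
  have "trues xs' + trues ys' + trues zs' \<le> 2 * N"
    using d disj3_trues[of xs' ys' zs' N] e by simp
  then show False using assms(4-7) d e by (auto split: if_splits)
qed

lemma M3_fin_tendsto_p:
  assumes p: "1/2 < p" "p \<le> 2/3"
  shows "(\<lambda>n. M3_fin n p) \<longlonglongrightarrow> p"
proof (rule LIMSEQ_imp_Suc, rule tendsto_sandwich)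
  have "(\<lambda>n. p * mu p n (\<lambda>xs. 1/2 * real n < real (trues xs))) \<longlonglongrightarrow> p * 1"
    using p by (intro tendsto_intros mu_trues_tendsto_1) auto
  then show "(\<lambda>n. p * mu p n (\<lambda>xs. 1/2 * real n < real (trues xs))) \<longlonglongrightarrow> p" by simp
  show "\<forall>\<^sub>F n in sequentially. p * mu p n (\<lambda>xs. 1/2 * real n < real (trues xs)) \<le> M3_fin (Suc n) p"
    using eventually_ge_at_top[of 4]
  proof eventually_elim
    case (elim n)
    have "mu p n (\<lambda>xs. 1/2 * real n < real (trues xs)) \<le> mu p n (\<lambda>xs. star_like (True # xs))"
      using p by (intro mu_mono) auto
    moreover have "0 \<le> (1 - p) * mu p n (\<lambda>xs. star_like (False # xs))"
      using p by (intro mult_nonneg_nonneg mu_nonneg) auto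
    ultimately have "p * mu p n (\<lambda>xs. 1/2 * real n < real (trues xs)) \<le> mu p (Suc n) star_like"
      using p by (simp add: mult_left_mono add_increasing2)
    also have "\<dots> \<le> M3_fin (Suc n) p"
    proof (rule mu_le_M3_fin)
      show "\<not> disj3 xs ys zs" if "length xs = Suc n" "length ys = Suc n" "length zs = Suc n"
        "star_like xs" "star_like ys" "star_like zs" for xs ys zs
        using star_like_not_disj3 that elim by auto
      show "star_like ((replicate (Suc n) True)[i := False])" if "i < Suc n" for i
        using that elim trues_drop_one[of _ n] by (cases i) auto
    qed (use p in auto)
    finally show ?case .
  qed
  show "\<forall>\<^sub>F n in sequentially. M3_fin (Suc n) p \<le> p"
    using eventually_ge_at_top[of 4] by eventually_elim (use p in \<open>auto intro!: M3_fin_le_prob\<close>)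
qed auto

text \<open>The three-of-four family attains the upper bound for each n >= 4, so the sequence is
  eventually constant.\<close>

lemma M3_fin_tendsto_three_of_four:
  assumes p: "1/3 \<le> p" "p \<le> 1/2" and q: "q = 1 - p"
  shows "(\<lambda>n. M3_fin n p) \<longlonglongrightarrow> 4 * p ^ 3 * q + p ^ 4"
proof (rule tendsto_eventually)
  show "\<forall>\<^sub>F n in sequentially. M3_fin n p = 4 * p ^ 3 * q + p ^ 4"
    using eventually_ge_at_top[of 4]
  proof eventually_elim
    case (elim n)
    obtain N where N: "n = Suc (Suc (Suc (Suc N)))" using ge4_obtain[OF elim] by blast
    have "mu p n three_of_four \<le> M3_fin n p"
      using p N three_of_four_not_disj3[of _ N] three_of_four_drop[of _ N] by (intro mu_le_M3_fin) auto
    moreover have "mu p n three_of_four = 4 * p ^ 3 * q + p ^ 4"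
      by (simp add: N q algebra_simps eval_nat_numeral)
    moreover have "M3_fin n p \<le> 4 * p ^ 3 * q + p ^ 4"
      using stable_family.mu_le_three_of_four[OF _ elim p q] p elim by (intro M3_fin_le_stable) auto
    ultimately show ?case by simp
  qed
qed

text \<open>The point beyond 1 and 2 is what keeps a set through both in contact with [n] - {1} and
  [n] - {2} taken together; requiring it costs a vanishing share of p^2.\<close>

fun edge_like :: "bool list \<Rightarrow> bool" where
  "edge_like (a # b # xs) \<longleftrightarrow> (if a \<and> b then Suc 0 \<le> trues xs else a \<noteq> b \<and> trues xs = length xs)"
| "edge_like _ \<longleftrightarrow> False"

lemma edge_like_not_disj3:
  assumes "length xs = Suc (Suc N)" "length ys = Suc (Suc N)" "length zs = Suc (Suc N)" "0 < N"
    "edge_like xs" "edge_like ys" "edge_like zs"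
  shows "\<not> disj3 xs ys zs"
proof
  assume d: "disj3 xs ys zs"
  obtain a a' xs' b b' ys' c c' zs' where e: "xs = a # a' # xs'" "ys = b # b' # ys'" "zs = c # c' # zs'"
    "length xs' = N" "length ys' = N" "length zs' = N"
    using assms(1-3) by (auto simp: length_Suc_conv)
  have "trues xs' + trues ys' + trues zs' \<le> 2 * N"
    using d disj3_trues[of xs' ys' zs' N] e by simp
  then show False using assms(4-7) d e by (auto split: if_splits)
qed

lemma mu_trues_pos: "mu p n (\<lambda>xs. Suc 0 \<le> trues xs) = 1 - (1 - p) ^ n"
proof (induction n)
  case (Suc n)
  have "mu p (Suc n) (\<lambda>xs. Suc 0 \<le> trues xs) = p + (1 - p) * mu p n (\<lambda>xs. Suc 0 \<le> trues xs)"
    by simp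
  then show ?case unfolding Suc by (simp add: algebra_simps)
qed simp

lemma M3_fin_tendsto_square:
  assumes p: "0 < p" "p \<le> 1/3"
  shows "(\<lambda>n. M3_fin n p) \<longlonglongrightarrow> p\<^sup>2"
proof (rule LIMSEQ_imp_Suc, rule LIMSEQ_imp_Suc, rule tendsto_sandwich)
  have "(\<lambda>n. p\<^sup>2 * (1 - (1 - p) ^ n)) \<longlonglongrightarrow> p\<^sup>2 * (1 - 0)"
    using p by (intro tendsto_intros LIMSEQ_power_zero) auto
  then show "(\<lambda>n. p\<^sup>2 * (1 - (1 - p) ^ n)) \<longlonglongrightarrow> p\<^sup>2" by simp
  show "\<forall>\<^sub>F n in sequentially. p\<^sup>2 * (1 - (1 - p) ^ n) \<le> M3_fin (Suc (Suc n)) p"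
    using eventually_ge_at_top[of 4]
  proof eventually_elim
    case (elim n)
    have nn: "0 \<le> mu p n (\<lambda>xs. edge_like (a # b # xs))" for a b using p by (intro mu_nonneg) auto
    have TT: "mu p n (\<lambda>xs. edge_like (True # True # xs)) = 1 - (1 - p) ^ n"
      using mu_trues_pos[of p n] by simp
    have "mu p (Suc (Suc n)) edge_like = p\<^sup>2 * mu p n (\<lambda>xs. edge_like (True # True # xs))
      + p * (1 - p) * (mu p n (\<lambda>xs. edge_like (True # False # xs)) + mu p n (\<lambda>xs. edge_like (False # True # xs)))
      + (1 - p)\<^sup>2 * mu p n (\<lambda>xs. edge_like (False # False # xs))"
      by (simp add: algebra_simps power2_eq_square del: edge_like.simps)
    also have "\<dots> \<ge> p\<^sup>2 * (1 - (1 - p) ^ n)"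
      unfolding TT using nn p by (simp add: add_nonneg_nonneg mult_nonneg_nonneg del: edge_like.simps)
    finally have "p\<^sup>2 * (1 - (1 - p) ^ n) \<le> mu p (Suc (Suc n)) edge_like" .
    also have "\<dots> \<le> M3_fin (Suc (Suc n)) p"
    proof (rule mu_le_M3_fin)
      show "\<not> disj3 xs ys zs"
        if "length xs = Suc (Suc n)" "length ys = Suc (Suc n)" "length zs = Suc (Suc n)"
        "edge_like xs" "edge_like ys" "edge_like zs" for xs ys zs
        using edge_like_not_disj3 that elim by auto
      show "edge_like ((replicate (Suc (Suc n)) True)[i := False])" if "i < Suc (Suc n)" for i
        using that elim trues_drop_one[of _ n] by (cases i; cases "i - 1") auto
    qed (use p in auto)
    finally show ?case .
  qed
  show "\<forall>\<^sub>F n in sequentially. M3_fin (Suc (Suc n)) p \<le> p\<^sup>2"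
    using eventually_ge_at_top[of 4]
  proof eventually_elim
    case (elim n)
    then show ?case
      using stable_family.mu_le_square[OF _ refl p, of n] p by (intro M3_fin_le_stable) auto
  qed
qed auto

theorem theorem3:
  fixes p q :: real
  assumes "0 < p" and "p < 1" and "q = 1 - p"
  shows "(\<lambda>n. M3_fin n p) \<longlonglongrightarrow> M3 p \<and>
    (p \<le> 1/3 \<longrightarrow> M3 p = p ^ 2) \<and>
    (1/3 \<le> p \<and> p \<le> 1/2 \<longrightarrow> M3 p = 4 * p ^ 3 * q + p ^ 4) \<and>
    (1/2 < p \<and> p \<le> 2/3 \<longrightarrow> M3 p = p) \<and>
    (2/3 < p \<longrightarrow> M3 p = 1)"
proof -
  have M3: "(\<lambda>n. M3_fin n p) \<longlonglongrightarrow> L \<Longrightarrow> M3 p = L" for L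
    unfolding M3_def by (rule limI)
  have 1: "p \<le> 1/3 \<Longrightarrow> (\<lambda>n. M3_fin n p) \<longlonglongrightarrow> p ^ 2"
    using M3_fin_tendsto_square assms by blast
  have 2: "1/3 \<le> p \<Longrightarrow> p \<le> 1/2 \<Longrightarrow> (\<lambda>n. M3_fin n p) \<longlonglongrightarrow> 4 * p ^ 3 * q + p ^ 4"
    using M3_fin_tendsto_three_of_four assms by blast
  have 3: "1/2 < p \<Longrightarrow> p \<le> 2/3 \<Longrightarrow> (\<lambda>n. M3_fin n p) \<longlonglongrightarrow> p"
    using M3_fin_tendsto_p by blast
  have 4: "2/3 < p \<Longrightarrow> (\<lambda>n. M3_fin n p) \<longlonglongrightarrow> 1"
    using M3_fin_tendsto_1 assms by blast
  consider "p \<le> 1/3" | "1/3 \<le> p" "p \<le> 1/2" | "1/2 < p" "p \<le> 2/3" | "2/3 < p" by linarith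
  then have "(\<lambda>n. M3_fin n p) \<longlonglongrightarrow> M3 p"
  proof cases
    case a: 1
    show ?thesis using 1[OF a] M3[OF 1[OF a]] by simp
  next
    case a: 2
    show ?thesis using 2[OF a] M3[OF 2[OF a]] by simp
  next
    case a: 3
    show ?thesis using 3[OF a] M3[OF 3[OF a]] by simp
  next
    case a: 4
    show ?thesis using 4[OF a] M3[OF 4[OF a]] by simp
  qed
  then show ?thesis using M3[OF 1] M3[OF 2] M3[OF 3] M3[OF 4] by blast
qed

end
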